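(* In the two-period screening model described in the context, suppose that (Assumption 1, first order stochastic dominance ordering) $G(\cdot\mid\theta)$ is ordered in first order stochastic dominance by $\theta$, in the sense that $G(v\mid\theta)<G(v\mid\theta')$ for all $v$ and all $\theta'<\theta$; and (Assumption 2, regularity) the dynamic virtual value $$\varphi(\theta,v)=v+\frac{1-F(\theta)}{f(\theta)}\cdot\frac{\partial G(v\mid\theta)/\partial\theta}{g(v\mid\theta)}$$ is weakly increasing in both $\theta$ and $v$. Then the mechanism $(q^*,t^* )$ characterized by $$q^*(\theta,v)=\left(\frac{\alpha}{c}\,\varphi(\theta,v)\,\mathbb{I}_{[\varphi(\theta,v)\ge 0]}\right)^{\frac{1}{1-\alpha}},$$ together with the transfers $t^*(\theta,v)=v\,q^*(\theta,v)^{\alpha}-u(\theta,v)$ pinned down by $$u(\theta,v)=u(\theta,\underline v)+\int_{\underline v}^{v}q^*(\theta,x)^{\alpha}\,dx,$$ $$\mathrm{E}_v\big[u(\theta,v)\mid\theta\big]=-\int_{\underline\theta}^{\theta}\int_{\underline v}^{\overline v}q^*(x,v)^{\alpha}\,\frac{\partial G(v\mid x)}{\partial x}\,dv\,dx,$$ is optimal, i.e. it solves the seller's problem of maximizing expected profit subject to (IC0), (IC1) and (IR).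
   Context: A seller produces a quantity $q\ge 0$ of a good at constant marginal cost $c\ge 0$. A buyer with value $v$ who receives $q$ and pays a transfer $t$ has utility $u(v,q,t)=vq^{\alpha}-t$, with $\alpha\in(0,1)$. The seller's payoff is $t-qc$. Trade occurs in period 1. In period 0 the buyer privately observes a signal $\theta\in[\underline\theta,\overline\theta]\subset\mathbb{R}_+$, with distribution $F$ and density $f$. In period 1 the buyer privately observes the value $v$, which ranges over $[\underline v,\overline v]$. Its distribution conditional on $\theta$ is $G(\cdot\mid\theta)$, with density $g(\cdot\mid\theta)$. A mechanism $(q,t)$ specifies a quantity $q(\theta,v)\ge 0$ and a transfer $t(\theta,v)$ for each pair $(\theta,v)$. In a mechanism, $u(\theta,v):=u(v,q(\theta,v),t(\theta,v))=v\,q(\theta,v)^{\alpha}-t(\theta,v)$. $\mathrm{E}_v[\cdot\mid\theta]$ is the expectation over $v\sim G(\cdot\mid\theta)$. $\mathbb{I}_{[A]}$ equals 1 if $A$ holds and 0 otherwise. The seller chooses $(q,t)$ to maximize $\mathrm{E}_{\theta,v}[t(\theta,v)-q(\theta,v)c]$ subject to (IC0) $\mathrm{E}_v[u(v,q(\theta,v),t(\theta,v))\mid\theta]\ge\mathrm{E}_v[u(v,q(\theta',v),t(\theta',v))\mid\theta]$ for all $\theta,\theta'$; (IC1) $u(v,q(\theta,v),t(\theta,v))\ge u(v,q(\theta,v'),t(\theta,v'))$ for all $\theta,v,v'$; (IR) $\mathrm{E}_v[u(v,q(\theta,v),t(\theta,v))\mid\theta]\ge 0$ for all $\theta$. *)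

theory Defs
  imports "HOL-Probability.Probability"
begin

definition has_pos_density_on :: "real measure \<Rightarrow> (real \<Rightarrow> real) \<Rightarrow> real set \<Rightarrow> bool" where
  "has_pos_density_on M p S \<longleftrightarrow>
     prob_space M \<and> set_borel_measurable borel S p \<and> (\<forall>x\<in>S. 0 < p x) \<and>
     M = density lborel (\<lambda>x. ennreal (indicator S x * p x))"

text \<open>Signals lie in \<open>\<Theta>\<close> and values in \<open>V\<close>. Only the restriction of a mechanism to \<open>\<Theta> \<times> V\<close>
  is meaningful, so measurability and expectations are always taken relative to these sets.\<close>

definition joint_dist ::
  "real set \<Rightarrow> real set \<Rightarrow> (real \<Rightarrow> real) \<Rightarrow> (real \<Rightarrow> real \<Rightarrow> real) \<Rightarrow> (real \<times> real) measure" where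
  "joint_dist \<Theta> V f g =
     density lborel (\<lambda>(\<theta>, v). ennreal (indicator (\<Theta> \<times> V) (\<theta>, v) * (f \<theta> * g \<theta> v)))"

definition buyer_util :: "real \<Rightarrow> real \<Rightarrow> real \<Rightarrow> real \<Rightarrow> real" where
  "buyer_util \<alpha> v q t = v * q powr \<alpha> - t"

text \<open>The conditional expectation of the payoff of a buyer with signal \<open>\<theta>\<close> who reports \<open>\<theta>'\<close>.
  If \<open>q\<close> and \<open>t\<close> are measurable, \<open>q \<ge> 0\<close>, \<open>V\<close> is a compact interval and \<open>IC1\<close> holds, then the
  integrand is nondecreasing in \<open>v\<close>, hence bounded on \<open>V\<close>, so the integral always exists.\<close>

definition interim_util ::
  "real \<Rightarrow> real set \<Rightarrow> (real \<Rightarrow> real measure) \<Rightarrow>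
   (real \<Rightarrow> real \<Rightarrow> real) \<Rightarrow> (real \<Rightarrow> real \<Rightarrow> real) \<Rightarrow> real \<Rightarrow> real \<Rightarrow> real" where
  "interim_util \<alpha> V G q t \<theta> \<theta>' = (LINT v:V|G \<theta>. buyer_util \<alpha> v (q \<theta>' v) (t \<theta>' v))"

definition IC0 ::
  "real \<Rightarrow> real set \<Rightarrow> real set \<Rightarrow> (real \<Rightarrow> real measure) \<Rightarrow>
   (real \<Rightarrow> real \<Rightarrow> real) \<Rightarrow> (real \<Rightarrow> real \<Rightarrow> real) \<Rightarrow> bool" where
  "IC0 \<alpha> \<Theta> V G q t \<longleftrightarrow>
     (\<forall>\<theta>\<in>\<Theta>. \<forall>\<theta>'\<in>\<Theta>. interim_util \<alpha> V G q t \<theta> \<theta> \<ge> interim_util \<alpha> V G q t \<theta> \<theta>')"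

definition IC1 ::
  "real \<Rightarrow> real set \<Rightarrow> real set \<Rightarrow> (real \<Rightarrow> real \<Rightarrow> real) \<Rightarrow> (real \<Rightarrow> real \<Rightarrow> real) \<Rightarrow> bool" where
  "IC1 \<alpha> \<Theta> V q t \<longleftrightarrow>
     (\<forall>\<theta>\<in>\<Theta>. \<forall>v\<in>V. \<forall>v'\<in>V.
        buyer_util \<alpha> v (q \<theta> v) (t \<theta> v) \<ge> buyer_util \<alpha> v (q \<theta> v') (t \<theta> v'))"

definition IR ::
  "real \<Rightarrow> real set \<Rightarrow> real set \<Rightarrow> (real \<Rightarrow> real measure) \<Rightarrow>
   (real \<Rightarrow> real \<Rightarrow> real) \<Rightarrow> (real \<Rightarrow> real \<Rightarrow> real) \<Rightarrow> bool" where
  "IR \<alpha> \<Theta> V G q t \<longleftrightarrow> (\<forall>\<theta>\<in>\<Theta>. interim_util \<alpha> V G q t \<theta> \<theta> \<ge> 0)"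

definition expected_profit ::
  "real \<Rightarrow> real set \<Rightarrow> real set \<Rightarrow> (real \<Rightarrow> real) \<Rightarrow> (real \<Rightarrow> real \<Rightarrow> real) \<Rightarrow>
   (real \<Rightarrow> real \<Rightarrow> real) \<Rightarrow> (real \<Rightarrow> real \<Rightarrow> real) \<Rightarrow> real" where
  "expected_profit c \<Theta> V f g q t =
     (LINT (\<theta>, v):\<Theta> \<times> V|joint_dist \<Theta> V f g. t \<theta> v - q \<theta> v * c)"

text \<open>The Bochner integral of a non-integrable function is 0, so the existence of the expected
  profit has to be demanded explicitly.\<close>

definition feasible ::
  "real \<Rightarrow> real \<Rightarrow> real set \<Rightarrow> real set \<Rightarrow> (real \<Rightarrow> real) \<Rightarrow> (real \<Rightarrow> real \<Rightarrow> real) \<Rightarrow> (real \<Rightarrow> real measure) \<Rightarrow>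
   (real \<Rightarrow> real \<Rightarrow> real) \<Rightarrow> (real \<Rightarrow> real \<Rightarrow> real) \<Rightarrow> bool" where
  "feasible \<alpha> c \<Theta> V f g G q t \<longleftrightarrow>
     (\<forall>\<theta>\<in>\<Theta>. \<forall>v\<in>V. 0 \<le> q \<theta> v) \<and>
     set_borel_measurable borel (\<Theta> \<times> V) (\<lambda>(\<theta>, v). q \<theta> v) \<and>
     set_borel_measurable borel (\<Theta> \<times> V) (\<lambda>(\<theta>, v). t \<theta> v) \<and>
     set_integrable (joint_dist \<Theta> V f g) (\<Theta> \<times> V) (\<lambda>(\<theta>, v). t \<theta> v - q \<theta> v * c) \<and>
     IC0 \<alpha> \<Theta> V G q t \<and> IC1 \<alpha> \<Theta> V q t \<and> IR \<alpha> \<Theta> V G q t"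

definition optimal_mechanism ::
  "real \<Rightarrow> real \<Rightarrow> real set \<Rightarrow> real set \<Rightarrow> (real \<Rightarrow> real) \<Rightarrow> (real \<Rightarrow> real \<Rightarrow> real) \<Rightarrow> (real \<Rightarrow> real measure) \<Rightarrow>
   (real \<Rightarrow> real \<Rightarrow> real) \<Rightarrow> (real \<Rightarrow> real \<Rightarrow> real) \<Rightarrow> bool" where
  "optimal_mechanism \<alpha> c \<Theta> V f g G q t \<longleftrightarrow>
     is_arg_max (\<lambda>(q, t). expected_profit c \<Theta> V f g q t)
       (\<lambda>(q, t). feasible \<alpha> c \<Theta> V f g G q t) (q, t)"

text \<open>The argument \<open>dG\<close> stands for the partial derivative of \<open>cdf (G \<theta>) v\<close> with respect to \<open>\<theta>\<close>.\<close>

definition virtual_value ::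
  "real measure \<Rightarrow> (real \<Rightarrow> real) \<Rightarrow> (real \<Rightarrow> real \<Rightarrow> real) \<Rightarrow> (real \<Rightarrow> real \<Rightarrow> real) \<Rightarrow>
   real \<Rightarrow> real \<Rightarrow> real" where
  "virtual_value F f g dG \<theta> v = v + (1 - cdf F \<theta>) / f \<theta> * (dG \<theta> v / g \<theta> v)"

definition q_star :: "real \<Rightarrow> real \<Rightarrow> (real \<Rightarrow> real \<Rightarrow> real) \<Rightarrow> real \<Rightarrow> real \<Rightarrow> real" where
  "q_star \<alpha> c \<phi> \<theta> v = (\<alpha> / c * \<phi> \<theta> v * of_bool (\<phi> \<theta> v \<ge> 0)) powr (1 / (1 - \<alpha>))"

text \<open>The two equations that determine the transfers \<open>t\<close> accompanying a quantity schedule \<open>q\<close>;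
  here \<open>u\<close> is the ex post utility that the mechanism \<open>(q, t)\<close> itself induces.\<close>

definition transfer_equations ::
  "real \<Rightarrow> real \<Rightarrow> real \<Rightarrow> real \<Rightarrow> real \<Rightarrow> (real \<Rightarrow> real measure) \<Rightarrow> (real \<Rightarrow> real \<Rightarrow> real) \<Rightarrow>
   (real \<Rightarrow> real \<Rightarrow> real) \<Rightarrow> (real \<Rightarrow> real \<Rightarrow> real) \<Rightarrow> bool" where
  "transfer_equations \<alpha> \<theta>l \<theta>h vl vh G dG q t \<longleftrightarrow>
     (let u = (\<lambda>\<theta> v. buyer_util \<alpha> v (q \<theta> v) (t \<theta> v)) in
        (\<forall>\<theta>\<in>{\<theta>l..\<theta>h}. \<forall>v\<in>{vl..vh}.
           u \<theta> v = u \<theta> vl + (LINT x:{vl..v}|lborel. q \<theta> x powr \<alpha>)) \<and>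
        (\<forall>\<theta>\<in>{\<theta>l..\<theta>h}.
           (LINT v:{vl..vh}|G \<theta>. u \<theta> v) =
           - (LINT x:{\<theta>l..\<theta>}|lborel. LINT v:{vl..vh}|lborel. q x v powr \<alpha> * dG x v)))"

end

theory Submission
  imports Defs
begin

text \<open>By the one-dimensional envelope formula, (IC1) makes \<open>q\<^sup>\<alpha>\<close> monotone in \<open>v\<close> and determines the ex
  post utility up to a constant. Hence (IC0) bounds the increments of the interim utility \<open>U\<close> from below by
  \<open>\<integral> q(x,v)\<^sup>\<alpha> (G(v|x) - G(v|y)) dv\<close>, and this yields
  \<open>U \<theta> \<ge> \<integral>\<integral> q(x,v)\<^sup>\<alpha> (- \<partial>G(v|x)/\<partial>x) dv dx\<close>, the outer integral extending up to \<open>\<theta>\<close>. Integrating against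
  \<open>F\<close> and exchanging the order of integration bounds the profit by the expectation of
  \<open>\<phi> q\<^sup>\<alpha> - c q\<close>, which \<open>q\<^sup>*\<close> maximizes pointwise. The transfers \<open>t\<^sup>*\<close> turn the bound into an equality, and
  monotonicity of \<open>q\<^sup>*\<close> in both arguments makes the mechanism incentive compatible.\<close>

subsection \<open>Distributions with a density on an interval\<close>

text \<open>Two gaps in regularity shape the argument. \<open>dG\<close> is only a pointwise
  derivative, given with neither measurability nor a bound. And a feasible \<open>q\<close> is
  bounded in the value, being monotone on the compact set \<open>V\<close>, but not uniformly in the
  signal. Differentiating under the integral sign, as in the textbook envelope theorem, is therefore
  out of reach, and integrability of q^\<alpha> times the derivative cannot be presupposed: the
  Bochner integral of a non-integrable function would silently be 0. The double integral is first
  estimated with values in [0, \<infinity>], where first order stochastic dominance supplies the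
  sign; the finite bound \<open>U b - U a\<close> then proves integrability, and only afterwards are
  Fubini and the splitting of integrals available. For \<open>q_star\<close> the comparison runs the
  other way: regularity traps q^\<alpha> at intermediate signals between its values at two end
  signals, and the rents of the schedules frozen at these end signals are exactly the gains from
  misreporting that (IC0) has to deter.\<close>

lemma has_pos_density_onD:
  assumes "has_pos_density_on M p S" "S \<in> sets borel"
  shows has_pos_density_on_prob: "prob_space M"
    and has_pos_density_on_sets: "sets M = sets borel"
    and has_pos_density_on_space: "space M = UNIV"
    and has_pos_density_on_borel: "(\<lambda>x. indicator S x * p x) \<in> borel_measurable borel"
    and has_pos_density_on_nonneg: "0 \<le> indicator S x * p x"
    and has_pos_density_on_density: "M = density lborel (\<lambda>x. ennreal (indicator S x * p x))"
  using assms
  by (auto simp: has_pos_density_on_def set_borel_measurable_def split: split_indicator intro: less_imp_le)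

lemma set_integrable_has_pos_density_on_iff:
  fixes h :: "real \<Rightarrow> real"
  assumes M: "has_pos_density_on M p S" "S \<in> sets borel" and h: "set_borel_measurable borel S h"
  shows "set_integrable M S h \<longleftrightarrow> set_integrable lborel S (\<lambda>x. p x * h x)"
proof -
  have "set_integrable M S h \<longleftrightarrow> integrable lborel (\<lambda>x. (indicator S x * p x) *\<^sub>R (indicator S x *\<^sub>R h x))"
    unfolding set_integrable_def using h has_pos_density_onD[OF M]
    by (subst has_pos_density_on_density[OF M], subst integrable_density)
       (auto simp: set_borel_measurable_def)
  also have "(\<lambda>x. (indicator S x * p x) *\<^sub>R (indicator S x *\<^sub>R h x)) = (\<lambda>x. indicator S x *\<^sub>R (p x * h x))"
    by (auto split: split_indicator)
  finally show ?thesis by (simp add: set_integrable_def)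
qed

lemma set_integral_has_pos_density_on:
  fixes h :: "real \<Rightarrow> real"
  assumes M: "has_pos_density_on M p S" "S \<in> sets borel" and h: "set_borel_measurable borel S h"
  shows "(LINT x:S|M. h x) = (LINT x:S|lborel. p x * h x)"
proof -
  have "(LINT x:S|M. h x) = (LINT x|lborel. (indicator S x * p x) *\<^sub>R (indicator S x *\<^sub>R h x))"
    unfolding set_lebesgue_integral_def using h has_pos_density_onD[OF M]
    by (subst has_pos_density_on_density[OF M], subst integral_density)
       (auto simp: set_borel_measurable_def)
  also have "(\<lambda>x. (indicator S x * p x) *\<^sub>R (indicator S x *\<^sub>R h x)) = (\<lambda>x. indicator S x *\<^sub>R (p x * h x))"
    by (auto split: split_indicator)
  finally show ?thesis by (simp add: set_lebesgue_integral_def)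
qed

lemma AE_has_pos_density_on:
  assumes M: "has_pos_density_on M p S" "S \<in> sets borel"
  shows "AE x in M. x \<in> S"
  using has_pos_density_onD[OF M]
  by (subst has_pos_density_on_density[OF M], subst AE_density) (auto split: split_indicator)

lemma emeasure_singleton_has_pos_density_on:
  assumes M: "has_pos_density_on M p S" "S \<in> sets borel"
  shows "emeasure M {x} = 0"
proof -
  have "AE y in lborel. y \<noteq> x" by (rule AE_lborel_singleton)
  then have "AE y in M. y \<noteq> x"
    using has_pos_density_onD[OF M]
    by (subst has_pos_density_on_density[OF M], subst AE_density) auto
  then have "{x} \<in> null_sets M"
    using has_pos_density_onD(2,3)[OF M] by (intro AE_iff_null_sets[THEN iffD2]) auto
  then show ?thesis by auto
qed

text \<open>The triangle \<open>x \<le> v\<close> used below has sections \<open>{x..}\<close>;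
  since \<open>M\<close> has no atoms, closing the half-line does not change its mass.\<close>

lemma measure_atLeast_has_pos_density_on:
  assumes M: "has_pos_density_on M p S" "S \<in> sets borel"
  shows "measure M {x..} = 1 - cdf M x"
proof -
  interpret prob_space M using has_pos_density_onD(1)[OF M] by simp
  note s[simp] = has_pos_density_onD(2,3)[OF M]
  have "prob {x<..} = 1 - prob {..x}"
    by (subst prob_compl[symmetric]) (auto simp: Compl_eq_Diff_UNIV[symmetric])
  moreover have "prob {x..} = prob ({x} \<union> {x<..})"
    by (rule arg_cong[where f=prob]) auto
  moreover have "\<dots> = prob {x} + prob {x<..}"
    by (rule finite_measure_Union) auto
  moreover have "prob {x} = 0"
    using emeasure_singleton_has_pos_density_on[OF M] by (simp add: measure_def)
  ultimately show ?thesis by (simp add: cdf_def)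
qed

lemma cdf_bounds:
  assumes M: "has_pos_density_on M p S" "S \<in> sets borel"
  shows "0 \<le> cdf M x" "cdf M x \<le> 1"
proof -
  interpret prob_space M using has_pos_density_onD(1)[OF M] by simp
  show "0 \<le> cdf M x" "cdf M x \<le> 1" by (auto simp: cdf_def)
qed

lemma borel_measurable_cdf:
  assumes M: "has_pos_density_on M p S" "S \<in> sets borel"
  shows "cdf M \<in> borel_measurable borel"
proof -
  interpret real_distribution M
    using has_pos_density_onD(1-3)[OF M] by (auto simp: real_distribution_def real_distribution_axioms_def)
  show ?thesis
    by (intro borel_measurable_mono monoI cdf_nondecreasing)
qed

text \<open>Fubini on the triangle \<open>x \<le> v\<close>, in effect an integration by parts. It
  serves twice: with \<open>M = G \<theta>\<close> it turns the envelope formula into interim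
  utility, and with \<open>M = F\<close> it produces the factor \<open>1 - cdf F \<theta>\<close> of
  the virtual value.\<close>

lemma
  fixes W :: "real \<Rightarrow> real"
  assumes M: "has_pos_density_on M p {a..b}" and W: "set_integrable lborel {a..b} W"
  shows set_integrable_indefinite: "set_integrable M {a..b} (\<lambda>v. LINT x:{a..v}|lborel. W x)"
    and set_integrable_tail: "set_integrable lborel {a..b} (\<lambda>x. W x * (1 - cdf M x))"
    and set_integral_indefinite:
      "(LINT v:{a..b}|M. LINT x:{a..v}|lborel. W x) = (LINT x:{a..b}|lborel. W x * (1 - cdf M x))"
proof -
  note s[simp] = has_pos_density_onD(2,3)[OF M]
  interpret prob_space M using has_pos_density_onD(1)[OF M] by simp
  interpret P: pair_sigma_finite M lborel ..
  define w where "w x = indicator {a..b} x * W x" for x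
  have w[measurable]: "integrable lborel w" using W by (simp add: set_integrable_def w_def[abs_def])
  then have [measurable]: "w \<in> borel_measurable borel" by auto
  \<comment> \<open>Dominated by \<open>w\<close>, which is integrable on the product because
    \<open>M\<close> has mass 1. Integrating out \<open>x\<close> gives the indefinite integral,
    integrating out \<open>v\<close> the mass of \<open>{x..}\<close>.\<close>
  define k :: "real \<Rightarrow> real \<Rightarrow> real" where "k v x = indicator {(v, x). x \<le> v} (v, x) * w x" for v x
  have km[measurable]: "case_prod k \<in> borel_measurable (M \<Otimes>\<^sub>M lborel)"
  proof -
    have "Measurable.pred (M \<Otimes>\<^sub>M lborel) (\<lambda>(v, x). x \<le> v)"
      using s(1) by (subst measurable_cong_sets[OF sets_pair_measure_cong[OF s(1) sets_lborel] refl]) measurable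
    then show ?thesis unfolding k_def by measurable
  qed
  have int: "integrable (M \<Otimes>\<^sub>M lborel) (case_prod k)"
  proof (rule Bochner_Integration.integrable_bound)
    show "integrable (M \<Otimes>\<^sub>M lborel) (\<lambda>(v,x). w x)"
      using w by (intro P.Fubini_integrable) (auto simp: measurable_pair_iff)
  qed (auto simp: k_def split: split_indicator)
  have eq1: "(LINT x|lborel. k v x) = (LINT x:{a..v}|lborel. W x)" if "v \<in> {a..b}" for v
    unfolding set_lebesgue_integral_def k_def w_def using that
    by (intro Bochner_Integration.integral_cong) (auto split: split_indicator)
  have eq2: "(LINT v|M. k v x) = indicator {a..b} x *\<^sub>R (W x * (1 - cdf M x))" for x
  proof -
    have "(\<lambda>v. k v x) = (\<lambda>v. indicator {x..} v * w x)" by (auto simp: k_def split: split_indicator)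
    then show ?thesis
      using measure_atLeast_has_pos_density_on[OF M, of x] by (simp add: w_def)
  qed
  show "set_integrable lborel {a..b} (\<lambda>x. W x * (1 - cdf M x))"
    using P.integrable_snd[OF int] by (simp add: eq2 set_integrable_def)
  have int1: "integrable M (\<lambda>v. LINT x|lborel. k v x)"
    using P.integrable_fst[OF int] by simp
  have "integrable M (\<lambda>v. indicator {a..b} v *\<^sub>R (LINT x|lborel. k v x))"
    by (rule integrable_mult_indicator[OF _ int1]) simp
  also have "(\<lambda>v. indicator {a..b} v *\<^sub>R (LINT x|lborel. k v x)) =
    (\<lambda>v. indicator {a..b} v *\<^sub>R (LINT x:{a..v}|lborel. W x))"
    using eq1 by (auto split: split_indicator)
  finally show "set_integrable M {a..b} (\<lambda>v. LINT x:{a..v}|lborel. W x)"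
    by (simp add: set_integrable_def)
  have "(LINT v:{a..b}|M. LINT x:{a..v}|lborel. W x) = (LINT v|M. LINT x|lborel. k v x)"
    unfolding set_lebesgue_integral_def[of M]
    by (rule integral_cong_AE) (use AE_has_pos_density_on[OF M] eq1 int1 \<open>set_integrable M {a..b} (\<lambda>v. LINT x:{a..v}|lborel. W x)\<close> in \<open>auto simp: set_integrable_def\<close>)
  also have "\<dots> = (LINT x|lborel. LINT v|M. k v x)"
    using P.Fubini_integral[OF int] by simp
  finally show "(LINT v:{a..b}|M. LINT x:{a..v}|lborel. W x) = (LINT x:{a..b}|lborel. W x * (1 - cdf M x))"
    by (simp add: eq2 set_lebesgue_integral_def)
qed

subsection \<open>The one-dimensional envelope formula\<close>

lemma set_borel_measurable_mono_on:
  fixes p :: "real \<Rightarrow> real"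
  assumes "mono_on {a..b} p"
  shows "set_borel_measurable borel {a..b} p"
  using borel_measurable_mono_on_fnc[OF assms]
  by (simp add: set_borel_measurable_def borel_measurable_restrict_space_iff)

lemma abs_le_mono_on:
  fixes p :: "real \<Rightarrow> real"
  assumes "mono_on {a..b} p" "x \<in> {a..b}"
  shows "\<bar>p x\<bar> \<le> \<bar>p a\<bar> + \<bar>p b\<bar>"
  using mono_onD[OF assms(1), of a x] mono_onD[OF assms(1), of x b] assms(2) by auto

lemma set_integrable_bounded:
  fixes h :: "'a \<Rightarrow> real"
  assumes h: "set_borel_measurable M S h" and fin: "emeasure M S < \<infinity>" and S: "S \<in> sets M"
    and bd: "\<And>x. x \<in> S \<Longrightarrow> \<bar>h x\<bar> \<le> B"
  shows "set_integrable M S h"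
  unfolding set_integrable_def
proof (rule Bochner_Integration.integrable_bound)
  show "integrable M (\<lambda>x. indicator S x *\<^sub>R B)" using fin S by auto
  show "AE x in M. norm (indicator S x *\<^sub>R h x) \<le> norm (indicator S x *\<^sub>R B)"
    by (intro AE_I2) (auto split: split_indicator intro: order_trans[OF bd abs_ge_self])
qed (use h in \<open>simp add: set_borel_measurable_def\<close>)

lemma set_integrable_mono_on:
  fixes p :: "real \<Rightarrow> real"
  assumes "mono_on {a..b} p"
  shows "set_integrable lborel {a..b} p"
proof (rule set_integrable_bounded)
  show "set_borel_measurable lborel {a..b} p"
    using set_borel_measurable_mono_on[OF assms] by (simp add: set_borel_measurable_def)
  show "emeasure lborel {a..b} < \<infinity>" by (cases "a \<le> b") auto
qed (use abs_le_mono_on[OF assms] in auto)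

text \<open>The hypothesis says that \<open>p\<close> selects subgradients of \<open>u\<close>,
  which is how (IC1) will be read. Adding it to the version with \<open>v\<close> and
  \<open>w\<close> exchanged cancels \<open>u\<close>.\<close>

lemma slope_sandwich_mono_on:
  fixes u p :: "real \<Rightarrow> real"
  assumes "\<And>v w. v \<in> {a..b} \<Longrightarrow> w \<in> {a..b} \<Longrightarrow> (v - w) * p w \<le> u v - u w"
  shows "mono_on {a..b} p"
proof (rule mono_onI)
  fix v w assume *: "v \<in> {a..b}" "w \<in> {a..b}" "v \<le> w"
  have "(w - v) * p v \<le> (w - v) * p w"
    using assms[of v w] assms[of w v] * by (simp add: algebra_simps)
  then show "p v \<le> p w" using *(3) by (cases "v = w") auto
qed

text \<open>The defect \<open>D v = u v - \<integral> p\<close> changes by at most \<open>\<bar>v - w\<bar> * \<bar>p v - p w\<bar>\<close>. Summed over \<open>n\<close> equal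
  pieces this telescopes to a bound of order \<open>1 / n\<close>, so \<open>D\<close> is constant.\<close>

lemma slope_sandwich_integral:
  fixes u p :: "real \<Rightarrow> real"
  assumes slope: "\<And>v w. v \<in> {a..b} \<Longrightarrow> w \<in> {a..b} \<Longrightarrow> (v - w) * p w \<le> u v - u w"
    and v: "v \<in> {a..b}"
  shows "u v = u a + (LINT x:{a..v}|lborel. p x)"
proof -
  have mono: "mono_on {a..b} p" using slope_sandwich_mono_on[OF slope] .
  have int: "p integrable_on {x..y}" if "a \<le> x" "y \<le> b" for x y
    using that by (intro integrable_on_mono_on mono_on_subset[OF mono]) auto
  define D where "D y = u y - integral {a..y} p" for y
  have D: "\<bar>D y - D x\<bar> \<le> (y - x) * (p y - p x)" if "a \<le> x" "x \<le> y" "y \<le> b" for x y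
  proof -
    have "integral {a..x} p + integral {x..y} p = integral {a..y} p"
      using that int by (intro Henstock_Kurzweil_Integration.integral_combine) auto
    moreover have "(y - x) * p x \<le> integral {x..y} p"
    proof -
      have "integral {x..y} (\<lambda>_. p x) \<le> integral {x..y} p"
        using that int by (intro integral_le) (auto intro!: mono_onD[OF mono])
      then show ?thesis using that by simp
    qed
    moreover have "integral {x..y} p \<le> (y - x) * p y"
    proof -
      have "integral {x..y} p \<le> integral {x..y} (\<lambda>_. p y)"
        using that int by (intro integral_le) (auto intro!: mono_onD[OF mono])
      then show ?thesis using that by simp
    qed
    moreover have "(y - x) * p x \<le> u y - u x" "(x - y) * p y \<le> u x - u y"
      using slope[of y x] slope[of x y] that by auto
    ultimately show ?thesis
      by (auto simp: D_def algebra_simps abs_le_iff)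
  qed
  have bound: "\<bar>D v - D a\<bar> \<le> (v - a) * (p v - p a) / real (Suc n)" for n
  proof -
    define x where "x i = a + (v - a) * (real i / real (Suc n))" for i
    have x_mono: "x i \<le> x (Suc i)" for i
      using v by (auto simp: x_def intro!: mult_left_mono divide_right_mono)
    have x_lo: "a \<le> x i" for i using v by (auto simp: x_def)
    have x_hi: "x i \<le> b" if "i \<le> Suc n" for i
    proof -
      have "x i \<le> a + (v - a) * 1"
        unfolding x_def using v that by (intro add_left_mono mult_left_mono) auto
      then show ?thesis using v by simp
    qed
    have x_ends: "x 0 = a" "x (Suc n) = v" by (auto simp: x_def)
    have step: "x (Suc i) - x i = (v - a) / real (Suc n)" for i
    proof -
      have "x (Suc i) - x i = (v - a) * ((real (Suc i) - real i) / real (Suc n))"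
        by (simp only: x_def diff_divide_distrib right_diff_distrib)
      then show ?thesis by simp
    qed
    have "D v - D a = (\<Sum>i<Suc n. D (x (Suc i)) - D (x i))"
      by (subst sum_lessThan_telescope) (simp add: x_ends)
    then have "\<bar>D v - D a\<bar> \<le> (\<Sum>i<Suc n. \<bar>D (x (Suc i)) - D (x i)\<bar>)"
      by (metis sum_abs)
    also have "\<dots> \<le> (\<Sum>i<Suc n. (x (Suc i) - x i) * (p (x (Suc i)) - p (x i)))"
      using x_mono x_lo x_hi by (intro sum_mono D) auto
    also have "\<dots> = (v - a) / real (Suc n) * (\<Sum>i<Suc n. p (x (Suc i)) - p (x i))"
      unfolding step sum_distrib_left ..
    also have "(\<Sum>i<Suc n. p (x (Suc i)) - p (x i)) = p v - p a"
      by (subst sum_lessThan_telescope) (simp add: x_ends)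
    finally show ?thesis by simp
  qed
  have "(\<lambda>n. (v - a) * (p v - p a) / real (Suc n)) \<longlonglongrightarrow> 0"
    using tendsto_mult_left[OF LIMSEQ_inverse_real_of_nat, of "(v - a) * (p v - p a)"]
    by (simp add: divide_inverse)
  then have "\<bar>D v - D a\<bar> \<le> 0"
    using bound by (intro LIMSEQ_le_const) auto
  then have "u v = u a + integral {a..v} p" by (simp add: D_def)
  moreover have "set_integrable lborel {a..v} p"
    using v by (intro set_integrable_mono_on mono_on_subset[OF mono]) auto
  ultimately show ?thesis using set_borel_integral_eq_integral(2) by metis
qed

text \<open>After a shift of variable the two integrals overlap, and only the strip of width
  \<open>h\<close> at \<open>b\<close> minus the one at \<open>a\<close> survives. This is the bound
  on difference quotients, uniform in \<open>h\<close>, that Fatou's lemma needs.\<close>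

lemma nn_integral_increment_le:
  fixes U :: "real \<Rightarrow> real"
  assumes U: "mono_on {a..b} U" and h: "0 < h" "h \<le> b - a"
  shows "(\<integral>\<^sup>+x. ennreal (indicator {a..b - h} x * (U (x + h) - U x)) \<partial>lborel) \<le> ennreal (h * (U b - U a))"
proof -
  have int: "U integrable_on {x..y}" if "a \<le> x" "y \<le> b" for x y
    using that by (intro integrable_on_mono_on mono_on_subset[OF U]) auto
  have Uh: "mono_on {a..b-h} (\<lambda>x. U (x + h))"
    using h by (auto intro!: mono_onI mono_onD[OF U])
  have U': "mono_on {a..b-h} U"
    using h by (intro mono_on_subset[OF U]) auto
  have si: "set_integrable lborel {a..b - h} (\<lambda>x. U (x + h) - U x)"
    by (intro set_integral_diff set_integrable_mono_on Uh U')
  have nonneg: "0 \<le> indicator {a..b - h} x * (U (x + h) - U x)" for x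
    using h by (auto intro!: mono_onD[OF U] split: split_indicator)
  have "integral {a..b - h} (\<lambda>x. U (x + h) - U x) = integral {a..b-h} (\<lambda>x. U (x + h)) - integral {a..b-h} U"
    using Uh U' by (intro Henstock_Kurzweil_Integration.integral_diff integrable_on_mono_on)
  also have "integral {a..b-h} (\<lambda>x. U (x + h)) = integral {a+h..b} U"
    using integral_shift_Icc_real[of a "b - h" U h] by (simp add: o_def add.commute)
  also have "integral {a+h..b} U = integral {a..b} U - integral {a..a+h} U"
    using Henstock_Kurzweil_Integration.integral_combine[of a "a + h" b U] int h by auto
  also have "integral {a..b-h} U = integral {a..b} U - integral {b-h..b} U"
    using Henstock_Kurzweil_Integration.integral_combine[of a "b - h" b U] int h by auto
  finally have "integral {a..b - h} (\<lambda>x. U (x + h) - U x) = integral {b-h..b} U - integral {a..a+h} U"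
    by simp
  moreover have "integral {b-h..b} U \<le> integral {b-h..b} (\<lambda>_. U b)"
    using h int by (intro integral_le) (auto intro!: mono_onD[OF U])
  moreover have "integral {a..a+h} (\<lambda>_. U a) \<le> integral {a..a+h} U"
    using h int by (intro integral_le) (auto intro!: mono_onD[OF U])
  ultimately have "integral {a..b - h} (\<lambda>x. U (x + h) - U x) \<le> h * (U b - U a)"
    using h by (simp add: algebra_simps)
  moreover have "(\<integral>\<^sup>+x. ennreal (indicator {a..b - h} x * (U (x + h) - U x)) \<partial>lborel) =
    ennreal (LINT x:{a..b - h}|lborel. U (x + h) - U x)"
    unfolding set_lebesgue_integral_def using si nonneg
    by (subst nn_integral_eq_integral) (auto simp: set_integrable_def)
  ultimately show ?thesis
    using set_borel_integral_eq_integral(2)[OF si] by (auto intro: ennreal_leI)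
qed

lemma set_borel_measurable_restrict_space_iff:
  fixes h :: "'a::topological_space \<Rightarrow> real"
  assumes "S \<in> sets borel"
  shows "set_borel_measurable borel S h \<longleftrightarrow> h \<in> borel_measurable (restrict_space borel S)"
  using assms by (simp add: set_borel_measurable_def borel_measurable_restrict_space_iff)

subsection \<open>Pointwise maximization\<close>

text \<open>The tangent at 1 to a concave function; equivalently weighted AM-GM for \<open>s\<close>
  and 1 with weights \<alpha> and 1 - \<alpha>, whose arithmetic mean is \<open>m\<close>.\<close>

lemma powr_le_tangent:
  fixes s \<alpha> :: real
  assumes "0 \<le> s" "0 < \<alpha>" "\<alpha> < 1"
  shows "s powr \<alpha> \<le> 1 + \<alpha> * (s - 1)"
proof (cases "s = 0")
  case False
  define m where "m = 1 + \<alpha> * (s - 1)"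
  have m_alt: "m = \<alpha> * s + (1 - \<alpha>)" by (simp add: m_def algebra_simps)
  have s: "0 < s" and m: "0 < m"
    using assms False by (auto simp: m_alt intro!: add_pos_pos)
  \<comment> \<open>Averaged with weights \<alpha> and 1 - \<alpha>, the two right-hand sides cancel
    precisely because \<open>m\<close> is the weighted mean of \<open>s\<close> and 1.\<close>
  have "ln (s / m) \<le> s / m - 1" "ln (1 / m) \<le> 1 / m - 1"
    using s m by (auto intro!: ln_le_minus_one)
  then have "\<alpha> * (ln s - ln m) + (1 - \<alpha>) * - ln m \<le> \<alpha> * (s / m - 1) + (1 - \<alpha>) * (1 / m - 1)"
    using s m assms by (intro add_mono mult_left_mono) (auto simp: ln_div)
  also have "\<dots> = (\<alpha> * s + (1 - \<alpha>)) / m - 1"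
    by (simp add: algebra_simps add_divide_distrib diff_divide_distrib)
  also have "\<dots> = 0" using m by (simp flip: m_alt)
  finally have "\<alpha> * ln s \<le> ln m" by (simp add: algebra_simps)
  then have "exp (\<alpha> * ln s) \<le> m" using m by (metis exp_le_cancel_iff exp_ln)
  then show ?thesis using s m by (simp add: powr_def m_def)
qed (use assms in auto)

text \<open>For a nonpositive virtual value every positive quantity is harmful and the indicator
  selects 0. Otherwise the objective is concave in \<open>q\<close> and \<open>q_star\<close> solves
  its first-order condition.\<close>

lemma q_star_maximizes:
  fixes q :: real
  assumes a: "0 < \<alpha>" "\<alpha> < 1" and c: "0 < c" and q: "0 \<le> q"
  shows "\<phi> \<theta> v * q powr \<alpha> - c * q \<le> \<phi> \<theta> v * q_star \<alpha> c \<phi> \<theta> v powr \<alpha> - c * q_star \<alpha> c \<phi> \<theta> v"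
proof (cases "\<phi> \<theta> v \<le> 0")
  case True
  then have "q_star \<alpha> c \<phi> \<theta> v = 0" by (auto simp: q_star_def)
  moreover have "\<phi> \<theta> v * q powr \<alpha> \<le> 0" "0 \<le> c * q"
    using True c q by (auto intro: mult_nonpos_nonneg)
  ultimately show ?thesis by simp
next
  case False
  define y where "y = \<phi> \<theta> v"
  define Q where "Q = (\<alpha> / c * y) powr (1 / (1 - \<alpha>))"
  have y: "0 < y" using False by (simp add: y_def)
  have Qs: "q_star \<alpha> c \<phi> \<theta> v = Q" using y by (simp add: q_star_def Q_def y_def)
  have Q: "0 < Q" using y a c by (simp add: Q_def)
  have "Q powr (1 - \<alpha>) = \<alpha> / c * y"
    using a c y by (simp add: Q_def powr_powr)
  then have foc: "y * \<alpha> = c * Q powr (1 - \<alpha>)" using c by (simp add: field_simps)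
  have "Q powr \<alpha> * Q powr (1 - \<alpha>) = Q" using Q by (simp flip: powr_add)
  then have foc': "y * Q powr \<alpha> * \<alpha> = c * Q"
    by (metis foc mult.assoc mult.commute)
  \<comment> \<open>Rescaling by \<open>Q\<close> moves the tangent from 1 to \<open>Q\<close>; by
    \<open>foc'\<close> its slope there is the marginal cost, so the dependence on \<open>q\<close>
    cancels against \<open>c * q\<close>.\<close>
  have "y * q powr \<alpha> = y * Q powr \<alpha> * (q / Q) powr \<alpha>"
    using Q q by (simp add: powr_divide)
  also have "\<dots> \<le> y * Q powr \<alpha> * (1 + \<alpha> * (q / Q - 1))"
    using y Q q a by (intro mult_left_mono powr_le_tangent) auto
  also have "\<dots> = y * Q powr \<alpha> + (y * Q powr \<alpha> * \<alpha>) * (q / Q - 1)"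
    by (simp add: algebra_simps)
  also have "\<dots> = y * Q powr \<alpha> + c * q - c * Q"
    unfolding foc' using Q by (simp add: algebra_simps)
  finally show ?thesis unfolding Qs by (simp add: y_def)
qed

lemma q_star_mono:
  assumes a: "0 < \<alpha>" "\<alpha> < 1" and c: "0 < c" and le: "\<phi> \<theta> v \<le> \<phi> \<theta>' v'"
  shows "q_star \<alpha> c \<phi> \<theta> v \<le> q_star \<alpha> c \<phi> \<theta>' v'"
proof -
  have "\<alpha> / c * \<phi> \<theta> v * of_bool (\<phi> \<theta> v \<ge> 0) \<le> \<alpha> / c * \<phi> \<theta>' v' * of_bool (\<phi> \<theta>' v' \<ge> 0)"
    using a c le by (auto simp: divide_right_mono)
  then show ?thesis
    unfolding q_star_def using a c by (intro powr_mono2) auto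
qed

subsection \<open>The screening model\<close>

locale screening =
  fixes \<alpha> c \<theta>l \<theta>h vl vh :: real
    and F :: "real measure" and G :: "real \<Rightarrow> real measure"
    and f :: "real \<Rightarrow> real" and g dG :: "real \<Rightarrow> real \<Rightarrow> real"
  assumes alpha: "0 < \<alpha>" "\<alpha> < 1" and cost: "0 < c"
    and signals: "\<theta>l < \<theta>h" and vals: "vl < vh"
    and F: "has_pos_density_on F f {\<theta>l..\<theta>h}"
    and G: "\<And>\<theta>. \<theta> \<in> {\<theta>l..\<theta>h} \<Longrightarrow> has_pos_density_on (G \<theta>) (g \<theta>) {vl..vh}"
    and g_meas: "set_borel_measurable borel ({\<theta>l..\<theta>h} \<times> {vl..vh}) (\<lambda>(\<theta>, v). g \<theta> v)"
    and dG: "\<And>\<theta> v. \<theta> \<in> {\<theta>l..\<theta>h} \<Longrightarrow> v \<in> {vl..vh} \<Longrightarrow>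
               ((\<lambda>x. cdf (G x) v) has_real_derivative dG \<theta> v) (at \<theta> within {\<theta>l..\<theta>h})"
    and fosd: "\<And>\<theta> \<theta>' v. \<theta> \<in> {\<theta>l..\<theta>h} \<Longrightarrow> \<theta>' \<in> {\<theta>l..\<theta>h} \<Longrightarrow> \<theta>' < \<theta> \<Longrightarrow> v \<in> {vl<..<vh} \<Longrightarrow>
               cdf (G \<theta>) v < cdf (G \<theta>') v"
begin

abbreviation "\<Theta> \<equiv> {\<theta>l..\<theta>h}"
abbreviation "V \<equiv> {vl..vh}"

lemma prob_F: "prob_space F" and sets_F [measurable_cong]: "sets F = sets borel"
  and prob_G: "\<theta> \<in> \<Theta> \<Longrightarrow> prob_space (G \<theta>)"
  using has_pos_density_onD[OF F] has_pos_density_onD[OF G] by auto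

lemma cdf_G_vl: "\<theta> \<in> \<Theta> \<Longrightarrow> cdf (G \<theta>) vl = 0"
  and cdf_G_vh: "\<theta> \<in> \<Theta> \<Longrightarrow> cdf (G \<theta>) vh = 1"
proof -
  assume \<theta>: "\<theta> \<in> \<Theta>"
  interpret prob_space "G \<theta>" using prob_G[OF \<theta>] .
  note s[simp] = has_pos_density_onD(2,3)[OF G[OF \<theta>], simplified]
  have "AE v in G \<theta>. v \<in> V" using AE_has_pos_density_on[OF G[OF \<theta>]] by simp
  then have "prob V = 1" by (subst prob_eq_1) auto
  moreover have "prob V \<le> prob {vl..}" by (rule finite_measure_mono) auto
  moreover have "prob V \<le> prob {..vh}" by (rule finite_measure_mono) auto
  moreover have "prob {vl..} \<le> 1" "prob {..vh} \<le> 1" "0 \<le> cdf (G \<theta>) vl" by (auto simp: cdf_def)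
  ultimately show "cdf (G \<theta>) vl = 0" "cdf (G \<theta>) vh = 1"
    using measure_atLeast_has_pos_density_on[OF G[OF \<theta>], of vl]
      measure_nonneg[of "G \<theta>" "{..vl}"] by (auto simp: cdf_def)
qed

text \<open>The strict order is imposed only between \<open>vl\<close> and \<open>vh\<close>; at
  these two points all the conditional distribution functions agree, with values 0 and 1.\<close>

lemma cdf_G_antimono:
  assumes "\<theta> \<in> \<Theta>" "\<theta>' \<in> \<Theta>" "\<theta>' \<le> \<theta>" "v \<in> V"
  shows "cdf (G \<theta>) v \<le> cdf (G \<theta>') v"
proof -
  consider "\<theta>' = \<theta>" | "v = vl" | "v = vh" | "\<theta>' < \<theta>" "v \<in> {vl<..<vh}"
    using assms by fastforce
  then show ?thesis
    using assms cdf_G_vl cdf_G_vh fosd[of \<theta> \<theta>' v] by cases auto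
qed

text \<open>\<open>G\<close> is just a family of measures, not a kernel, so joint measurability has
  to come from the density \<open>g\<close>: the distribution function is a parametrized integral of
  it.\<close>

lemma borel_measurable_cdf_G:
  "(\<lambda>(x, v). indicator \<Theta> x * cdf (G x) v) \<in> borel_measurable (borel \<Otimes>\<^sub>M borel)"
proof -
  define gb where "gb z = (indicator (\<Theta> \<times> V) z * (case z of (x, v) \<Rightarrow> g x v))" for z :: "real \<times> real"
  have [measurable]: "gb \<in> borel_measurable (borel \<Otimes>\<^sub>M borel)"
    using g_meas by (simp add: set_borel_measurable_def gb_def[abs_def] borel_prod)
  have "cdf (G x) v = enn2real (\<integral>\<^sup>+y. ennreal (gb (x, y)) * indicator {(v, y). y \<le> v} (v, y) \<partial>lborel)"
    if x: "x \<in> \<Theta>" for x v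
  proof -
    note M = G[OF x]
    have "emeasure (G x) {..v} = (\<integral>\<^sup>+y. ennreal (indicator V y * g x y) * indicator {..v} y \<partial>lborel)"
      using has_pos_density_onD[OF M]
      by (subst has_pos_density_on_density[OF M]; simp add: emeasure_density)
    also have "\<dots> = (\<integral>\<^sup>+y. ennreal (gb (x, y)) * indicator {(v, y). y \<le> v} (v, y) \<partial>lborel)"
      using x by (intro nn_integral_cong) (auto simp: gb_def split: split_indicator)
    finally show ?thesis by (simp add: cdf_def measure_def)
  qed
  then have "(\<lambda>(x, v). indicator \<Theta> x * cdf (G x) v) = (\<lambda>(x, v). indicator \<Theta> x *
    enn2real (\<integral>\<^sup>+y. ennreal (gb (x, y)) * indicator {(v, y). y \<le> v} (v, y) \<partial>lborel))"
    by (auto split: split_indicator)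
  also have "\<dots> \<in> borel_measurable (borel \<Otimes>\<^sub>M borel)" by measurable
  finally show ?thesis .
qed

section \<open>The derivative of the conditional distribution with respect to the signal\<close>

text \<open>The sign makes it nonnegative under stochastic dominance, and the extension by 0 lets
  integrals run over the whole line.\<close>

definition decline :: "real \<Rightarrow> real \<Rightarrow> real" where
  "decline x v = indicator (\<Theta> \<times> V) (x, v) * - dG x v"

text \<open>Sequences replace the filter limit for two purposes: along \<open>nearby\<close> they
  give sign and measurability of \<open>decline\<close>, and along equal steps to the right they
  feed Fatou's lemma.\<close>

lemma tendsto_difference_quotient:
  assumes "\<theta> \<in> \<Theta>" "v \<in> V"
    and y: "y \<longlonglongrightarrow> \<theta>" "eventually (\<lambda>n. y n \<in> \<Theta> \<and> y n \<noteq> \<theta>) sequentially"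
  shows "(\<lambda>n. (cdf (G \<theta>) v - cdf (G (y n)) v) / (y n - \<theta>)) \<longlonglongrightarrow> decline \<theta> v"
proof -
  have "((\<lambda>x. (cdf (G x) v - cdf (G \<theta>) v) / (x - \<theta>)) \<longlongrightarrow> dG \<theta> v) (at \<theta> within \<Theta>)"
    using dG[OF assms(1,2)] by (simp add: has_field_derivative_iff)
  moreover have "filterlim y (at \<theta> within \<Theta>) sequentially"
    using y by (simp add: filterlim_at)
  ultimately have "(\<lambda>n. (cdf (G (y n)) v - cdf (G \<theta>) v) / (y n - \<theta>)) \<longlonglongrightarrow> dG \<theta> v"
    by (rule filterlim_compose)
  from tendsto_minus[OF this] show ?thesis
    using assms by (simp add: decline_def minus_divide_left)
qed

text \<open>Points of \<open>\<Theta>\<close> other than \<open>x\<close> that tend to \<open>x\<close>, chosen on the left at the upper end point, so that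
  \<open>\<partial>G/\<partial>\<theta>\<close> is a limit of measurable quotients on all of \<open>\<Theta>\<close>.\<close>

definition nearby :: "nat \<Rightarrow> real \<Rightarrow> real" where
  "nearby n x = (if x < \<theta>h then min (x + 1 / real (Suc n)) \<theta>h else max (\<theta>h - 1 / real (Suc n)) \<theta>l)"

lemma nearby:
  assumes "x \<in> \<Theta>"
  shows nearby_mem: "nearby n x \<in> \<Theta>" and nearby_neq: "nearby n x \<noteq> x"
    and tendsto_nearby: "(\<lambda>n. nearby n x) \<longlonglongrightarrow> x"
proof -
  have pos: "0 < 1 / real (Suc n)" by simp
  show "nearby n x \<in> \<Theta>" "nearby n x \<noteq> x"
    using assms signals pos unfolding nearby_def atLeastAtMost_iff by (smt (verit))+
  have l: "(\<lambda>n. 1 / real (Suc n)) \<longlonglongrightarrow> 0"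
    using LIMSEQ_inverse_real_of_nat by (simp add: inverse_eq_divide)
  show "(\<lambda>n. nearby n x) \<longlonglongrightarrow> x"
  proof (cases "x < \<theta>h")
    case True
    have "(\<lambda>n. min (x + 1 / real (Suc n)) \<theta>h) \<longlonglongrightarrow> min (x + 0) \<theta>h"
      by (intro tendsto_intros l)
    then show ?thesis using True by (simp add: nearby_def)
  next
    case False
    have "(\<lambda>n. max (\<theta>h - 1 / real (Suc n)) \<theta>l) \<longlonglongrightarrow> max (\<theta>h - 0) \<theta>l"
      by (intro tendsto_intros l)
    then show ?thesis using False assms signals by (simp add: nearby_def)
  qed
qed

lemma tendsto_nearby_quotient:
  assumes "x \<in> \<Theta>" "v \<in> V"
  shows "(\<lambda>n. (cdf (G x) v - cdf (G (nearby n x)) v) / (nearby n x - x)) \<longlonglongrightarrow> decline x v"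
  using nearby[OF assms(1)] assms by (intro tendsto_difference_quotient always_eventually) blast+

lemma decline_nonneg: "0 \<le> decline x v"
proof (cases "x \<in> \<Theta> \<and> v \<in> V")
  case True
  have "0 \<le> (cdf (G x) v - cdf (G (nearby n x)) v) / (nearby n x - x)" for n
  proof (cases "x \<le> nearby n x")
    case le: True
    have "cdf (G (nearby n x)) v \<le> cdf (G x) v"
      using True le nearby_mem by (intro cdf_G_antimono) auto
    with le show ?thesis by simp
  next
    case False
    have "cdf (G x) v \<le> cdf (G (nearby n x)) v"
      using True False nearby_mem by (intro cdf_G_antimono) auto
    with False show ?thesis by (simp add: divide_nonpos_nonpos)
  qed
  then show ?thesis
    using tendsto_nearby_quotient[of x v] True by (intro tendsto_lowerbound) auto
next
  case False
  then have "(x, v) \<notin> \<Theta> \<times> V" by blast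
  then show ?thesis unfolding decline_def by simp
qed

lemma borel_measurable_decline: "(\<lambda>(x, v). decline x v) \<in> borel_measurable (borel \<Otimes>\<^sub>M borel)"
proof -
  note [measurable] = borel_measurable_cdf_G
  have m[measurable]: "nearby n \<in> borel_measurable borel" for n
    unfolding nearby_def by measurable
  define K where "K = (\<lambda>(x, v). indicator \<Theta> x * cdf (G x) v)"
  have [measurable]: "K \<in> borel_measurable (borel \<Otimes>\<^sub>M borel)" by (simp add: K_def)
  define Q where "Q n z = indicator (\<Theta> \<times> V) z * ((K z - K (nearby n (fst z), snd z)) / (nearby n (fst z) - fst z))"
    for n and z :: "real \<times> real"
  show ?thesis
  proof (rule borel_measurable_LIMSEQ_real)
    show "Q n \<in> borel_measurable (borel \<Otimes>\<^sub>M borel)" for n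
      unfolding Q_def by measurable
    show "(\<lambda>n. Q n z) \<longlonglongrightarrow> (case z of (x, v) \<Rightarrow> decline x v)" for z
    proof (cases "z \<in> \<Theta> \<times> V")
      case True
      then obtain x v where z: "z = (x, v)" "x \<in> \<Theta>" "v \<in> V" by auto
      have "Q n z = (cdf (G x) v - cdf (G (nearby n x)) v) / (nearby n x - x)" for n
        using z nearby_mem[of x n] by (simp add: Q_def K_def)
      then show ?thesis
        using z tendsto_nearby_quotient[of x v] by simp
    next
      case False
      then show ?thesis by (cases z) (simp only: Q_def decline_def, simp)
    qed
  qed
qed

text \<open>The fundamental theorem for the gauge integral accepts a derivative that is neither
  continuous nor known to be integrable; nonnegativity then turns the result into a Lebesgue
  integral.\<close>

lemma nn_integral_decline:
  assumes "a \<in> \<Theta>" "b \<in> \<Theta>" "a \<le> b" "v \<in> V"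
  shows "(\<integral>\<^sup>+x. ennreal (indicator {a..b} x * decline x v) \<partial>lborel) = ennreal (cdf (G a) v - cdf (G b) v)"
proof -
  have sub: "{a..b} \<subseteq> \<Theta>" using assms by auto
  have "((\<lambda>x. dG x v) has_integral (cdf (G b) v - cdf (G a) v)) {a..b}"
    using assms sub
    by (intro fundamental_theorem_of_calculus)
       (auto simp flip: has_real_derivative_iff_has_vector_derivative intro!: has_field_derivative_subset[OF dG])
  from has_integral_neg[OF this]
  have "((\<lambda>x. - dG x v) has_integral (cdf (G a) v - cdf (G b) v)) {a..b}" by simp
  moreover have "- dG x v = decline x v" if "x \<in> {a..b}" for x
    using that sub assms by (auto simp: decline_def)
  ultimately have "((\<lambda>x. decline x v) has_integral (cdf (G a) v - cdf (G b) v)) {a..b}"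
    by (rule has_integral_eq[rotated])
  then show ?thesis
    by (intro nn_integral_has_integral_lebesgue) (auto simp: decline_nonneg)
qed

text \<open>By Tonelli the signal may be integrated out first, which leaves a difference of two
  distribution functions, at most 1 on \<open>V\<close>. No bound on \<open>dG\<close> itself is
  available.\<close>

lemma integrable_decline: "integrable (lborel \<Otimes>\<^sub>M lborel) (\<lambda>(x, v). decline x v)"
proof (rule integrableI_nonneg)
  interpret pair_sigma_finite lborel lborel ..
  note [measurable] = borel_measurable_decline
  show m[measurable]: "(\<lambda>(x, v). decline x v) \<in> borel_measurable (lborel \<Otimes>\<^sub>M lborel)" by measurable
  have "(\<integral>\<^sup>+z. ennreal (case z of (x, v) \<Rightarrow> decline x v) \<partial>(lborel \<Otimes>\<^sub>M lborel)) =
    (\<integral>\<^sup>+v. (\<integral>\<^sup>+x. ennreal (decline x v) \<partial>lborel) \<partial>lborel)"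
    by (subst lborel_pair.nn_integral_snd[symmetric]) (auto simp: case_prod_beta)
  also have "\<dots> \<le> (\<integral>\<^sup>+v. indicator V v \<partial>lborel)"
  proof (rule nn_integral_mono)
    fix v
    have eq: "(\<integral>\<^sup>+x. ennreal (decline x v) \<partial>lborel) = (\<integral>\<^sup>+x. ennreal (indicator \<Theta> x * decline x v) \<partial>lborel)"
      by (intro nn_integral_cong) (auto simp: decline_def split: split_indicator)
    show "(\<integral>\<^sup>+x. ennreal (decline x v) \<partial>lborel) \<le> indicator V v"
    proof (cases "v \<in> V")
      case True
      then show ?thesis
        using cdf_bounds[OF G, of \<theta>l v] cdf_bounds[OF G, of \<theta>h v] signals
        by (subst eq, subst nn_integral_decline) auto
    qed (auto simp: decline_def)
  qed
  also have "\<dots> < \<infinity>" using vals by simp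
  finally show "(\<integral>\<^sup>+z. ennreal (case z of (x, v) \<Rightarrow> decline x v) \<partial>(lborel \<Otimes>\<^sub>M lborel)) < \<infinity>" .
qed (auto simp: decline_nonneg)

section \<open>Interim expectations and the rent forced by incentive compatibility\<close>

lemma set_integrable_mono_on_cdf_G:
  assumes r: "mono_on V r" and \<theta>: "\<theta> \<in> \<Theta>"
  shows "set_integrable lborel V (\<lambda>v. r v * cdf (G \<theta>) v)"
  unfolding set_integrable_def
proof (rule Bochner_Integration.integrable_bound)
  note [measurable] = borel_measurable_cdf[OF G[OF \<theta>], simplified]
  have rm[measurable]: "(\<lambda>v. indicator V v * r v) \<in> borel_measurable borel"
    using set_borel_measurable_mono_on[OF r] by (simp add: set_borel_measurable_def)
  show "integrable lborel (\<lambda>v. indicator V v *\<^sub>R r v)"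
    using set_integrable_mono_on[OF r] by (simp add: set_integrable_def)
  have "(\<lambda>v. indicator V v *\<^sub>R (r v * cdf (G \<theta>) v)) = (\<lambda>v. (indicator V v * r v) * cdf (G \<theta>) v)"
    by auto
  then show "(\<lambda>v. indicator V v *\<^sub>R (r v * cdf (G \<theta>) v)) \<in> borel_measurable lborel" by simp
  show "AE v in lborel. norm (indicator V v *\<^sub>R (r v * cdf (G \<theta>) v)) \<le> norm (indicator V v *\<^sub>R r v)"
    using cdf_bounds[OF G[OF \<theta>]]
    by (intro AE_I2) (auto simp: abs_mult mult_left_le split: split_indicator)
qed

text \<open>Here \<theta> is the true signal, entering through \<open>G \<theta>\<close> alone,
  while \<open>r\<close> and \<open>u\<close> may belong to a different report. The formula
  therefore covers misreports as well.\<close>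

lemma
  assumes r: "mono_on V r" and \<theta>: "\<theta> \<in> \<Theta>"
    and u: "\<And>v. v \<in> V \<Longrightarrow> u v = u vl + (LINT x:{vl..v}|lborel. r x)"
  shows set_integrable_envelope: "set_integrable (G \<theta>) V u"
    and set_integral_envelope:
      "(LINT v:V|G \<theta>. u v) = u vl + (LINT x:V|lborel. r x * (1 - cdf (G \<theta>) x))"
proof -
  interpret prob_space "G \<theta>" using prob_G[OF \<theta>] .
  note s[simp] = has_pos_density_onD(2,3)[OF G[OF \<theta>], simplified]
  have int: "set_integrable lborel V r" using set_integrable_mono_on[OF r] .
  have c: "set_integrable (G \<theta>) V (\<lambda>_. u vl)"
    unfolding set_integrable_def by (rule integrable_mult_indicator) auto
  have *: "set_integrable (G \<theta>) V (\<lambda>v. LINT x:{vl..v}|lborel. r x)"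
    by (rule set_integrable_indefinite[OF G[OF \<theta>] int])
  have "set_integrable (G \<theta>) V (\<lambda>v. u vl + (LINT x:{vl..v}|lborel. r x))"
    by (rule set_integral_add(1)[OF c *])
  then show "set_integrable (G \<theta>) V u"
    by (subst set_integrable_cong[OF refl refl u]) auto
  have "prob V = 1"
    using AE_has_pos_density_on[OF G[OF \<theta>]] by (subst prob_eq_1) auto
  then have "(LINT v:V|G \<theta>. u vl) = u vl" by (simp add: set_lebesgue_integral_def)
  moreover have "(LINT v:V|G \<theta>. u v) = (LINT v:V|G \<theta>. u vl + (LINT x:{vl..v}|lborel. r x))"
    by (rule set_lebesgue_integral_cong) (auto intro: u)
  ultimately show "(LINT v:V|G \<theta>. u v) = u vl + (LINT x:V|lborel. r x * (1 - cdf (G \<theta>) x))"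
    using set_integral_indefinite[OF G[OF \<theta>] int] by (simp add: set_integral_add(2)[OF c *])
qed

text \<open>For \<open>p\<close> equal to q^\<alpha>, this is the slope that an envelope theorem
  would assign to interim utility at signal \<open>x\<close>.\<close>

definition rent :: "(real \<Rightarrow> real \<Rightarrow> real) \<Rightarrow> real \<Rightarrow> real" where
  "rent p x = (LINT v|lborel. p x v * decline x v)"

lemma borel_measurable_times_decline:
  assumes p: "set_borel_measurable borel (\<Theta> \<times> V) (\<lambda>(x, v). p x v)"
  shows "(\<lambda>(x, v). p x v * decline x v) \<in> borel_measurable (borel \<Otimes>\<^sub>M borel)"
proof -
  note [measurable] = borel_measurable_decline
  have [measurable]: "(\<lambda>(x, v). indicator (\<Theta> \<times> V) (x, v) * p x v) \<in> borel_measurable (borel \<Otimes>\<^sub>M borel)"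
    using p by (simp add: set_borel_measurable_def borel_prod split_beta')
  have "(\<lambda>(x, v). p x v * decline x v) =
    (\<lambda>(x, v). (case (x, v) of (x, v) \<Rightarrow> indicator (\<Theta> \<times> V) (x, v) * p x v) * decline x v)"
    by (auto simp: decline_def split: split_indicator)
  also have "\<dots> \<in> borel_measurable (borel \<Otimes>\<^sub>M borel)" by measurable
  finally show ?thesis .
qed

text \<open>Integrating the incentive constraint between \<open>x\<close> and \<open>x + h\<close> over \<open>x\<close> bounds the difference
  quotients in \<open>h\<close> uniformly; Fatou's lemma then replaces differentiability of \<open>U\<close> and
  domination of the quotients, neither of which is available.\<close>

lemma nn_integral_rent_le:
  assumes p: "set_borel_measurable borel (\<Theta> \<times> V) (\<lambda>(x, v). p x v)"
    and nonneg: "\<And>x v. x \<in> \<Theta> \<Longrightarrow> v \<in> V \<Longrightarrow> 0 \<le> p x v"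
    and mono: "\<And>x. x \<in> \<Theta> \<Longrightarrow> mono_on V (p x)"
    and U: "\<And>x y. x \<in> \<Theta> \<Longrightarrow> y \<in> \<Theta> \<Longrightarrow> x \<le> y \<Longrightarrow>
              (LINT v:V|lborel. p x v * (cdf (G x) v - cdf (G y) v)) \<le> U y - U x"
    and ab: "a \<in> \<Theta>" "b \<in> \<Theta>" "a < b"
  shows "(\<integral>\<^sup>+x. (\<integral>\<^sup>+v. ennreal (indicator {a..b} x * (p x v * decline x v)) \<partial>lborel) \<partial>lborel) \<le> ennreal (U b - U a)"
proof -
  define h where "h n = (b - a) / real (Suc n)" for n
  have h: "0 < h n" "h n \<le> b - a" for n
    using ab by (auto simp: h_def divide_simps mult_le_cancel_left1)
  have h0: "h \<longlonglongrightarrow> 0"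
    using tendsto_mult_left[OF LIMSEQ_inverse_real_of_nat, of "b - a"]
    by (simp add: h_def[abs_def] divide_inverse)
  define pb where "pb = (\<lambda>z. indicator (\<Theta> \<times> V) z * (case z of (x, v) \<Rightarrow> p x v))"
  define K where "K = (\<lambda>(x, v). indicator \<Theta> x * cdf (G x) v)"
  have [measurable]: "pb \<in> borel_measurable (borel \<Otimes>\<^sub>M borel)" "K \<in> borel_measurable (borel \<Otimes>\<^sub>M borel)"
    using p borel_measurable_cdf_G by (simp_all add: set_borel_measurable_def pb_def borel_prod K_def)
  \<comment> \<open>The cutoff at \<open>b - h n\<close> keeps \<open>x + h n\<close> inside the
    interval on which \<open>U\<close> is controlled.\<close>
  define \<Phi> where "\<Phi> n x v = indicator {a..b - h n} x * (pb (x, v) * ((K (x, v) - K (x + h n, v)) / h n))"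
    for n x v
  have [measurable]: "(\<lambda>(x, v). \<Phi> n x v) \<in> borel_measurable (lborel \<Otimes>\<^sub>M lborel)" for n
    unfolding \<Phi>_def by measurable
  have \<Phi>_eq: "\<Phi> n x v = indicator V v * (p x v * (cdf (G x) v - cdf (G (x + h n)) v)) / h n"
    if "x \<in> {a..b - h n}" for n x v
  proof -
    have "x \<in> \<Theta>" "x + h n \<in> \<Theta>" using that ab h[of n] by auto
    with that show ?thesis by (auto simp: \<Phi>_def pb_def K_def split: split_indicator)
  qed
  have quot_nonneg: "0 \<le> indicator V v * (p x v * (cdf (G x) v - cdf (G y) v))"
    if "x \<in> \<Theta>" "y \<in> \<Theta>" "x \<le> y" for x y v
    using that by (auto intro!: mult_nonneg_nonneg nonneg cdf_G_antimono split: split_indicator)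
  have U_mono: "mono_on {a..b} U"
  proof (rule mono_onI)
    fix x y assume "x \<in> {a..b}" "y \<in> {a..b}" "x \<le> y"
    then have *: "x \<in> \<Theta>" "y \<in> \<Theta>" "x \<le> y" using ab by auto
    have "0 \<le> (LINT v:V|lborel. p x v * (cdf (G x) v - cdf (G y) v))"
      unfolding set_lebesgue_integral_def
      using quot_nonneg[OF *] by (intro integral_nonneg_AE AE_I2) simp
    with U[OF *] show "U x \<le> U y" by simp
  qed
  \<comment> \<open>At \<open>x = b\<close> every \<open>\<Phi> n\<close> vanishes while the limit
    need not; that single point is a null set.\<close>
  have lim: "(\<lambda>n. \<Phi> n x v) \<longlonglongrightarrow> indicator {a..b} x * (p x v * decline x v)" if "x \<noteq> b" for x v
  proof (cases "x \<in> {a..b} \<and> v \<in> V")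
    case True
    then have x: "x \<in> \<Theta>" "a \<le> x" "x < b" using that ab by auto
    have "(\<lambda>n. x + h n) \<longlonglongrightarrow> x + 0" by (intro tendsto_intros h0)
    moreover from this have ev: "eventually (\<lambda>n. x + h n < b) sequentially"
      using x by (intro order_tendstoD) auto
    then have "eventually (\<lambda>n. x + h n \<in> \<Theta> \<and> x + h n \<noteq> x) sequentially"
    proof eventually_elim
      case (elim n)
      then show ?case using h[of n] ab x by auto
    qed
    ultimately have "(\<lambda>n. (cdf (G x) v - cdf (G (x + h n)) v) / (x + h n - x)) \<longlonglongrightarrow> decline x v"
      using True x by (intro tendsto_difference_quotient) auto
    from tendsto_mult_left[OF this, of "p x v"]
    have "(\<lambda>n. p x v * ((cdf (G x) v - cdf (G (x + h n)) v) / h n)) \<longlonglongrightarrow> p x v * decline x v"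
      by simp
    moreover from ev have "eventually (\<lambda>n. p x v * ((cdf (G x) v - cdf (G (x + h n)) v) / h n) = \<Phi> n x v) sequentially"
    proof eventually_elim
      case (elim n)
      then show ?case using x True by (subst \<Phi>_eq) auto
    qed
    ultimately have "(\<lambda>n. \<Phi> n x v) \<longlonglongrightarrow> p x v * decline x v"
      by (rule Lim_transform_eventually)
    then show ?thesis using True by simp
  next
    case False
    have z: "\<Phi> n x v = 0" for n
    proof (cases "v \<in> V")
      case True
      with False h[of n] have "x \<notin> {a..b - h n}" by auto
      then show ?thesis by (simp add: \<Phi>_def)
    qed (simp add: \<Phi>_def pb_def)
    have "indicator {a..b} x * (p x v * decline x v) = 0"
      using False by (auto simp: decline_def)
    then show ?thesis unfolding z by (simp only: tendsto_const)
  qed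
  \<comment> \<open>The constraint \<open>U\<close>, divided by \<open>h n\<close>, bounds the inner
    integral by a difference quotient of \<open>U\<close>; integrating that over \<open>x\<close>
    returns a factor \<open>h n\<close>, so the bound does not depend on \<open>n\<close>.\<close>
  have bound: "(\<integral>\<^sup>+x. (\<integral>\<^sup>+v. ennreal (\<Phi> n x v) \<partial>lborel) \<partial>lborel) \<le> ennreal (U b - U a)" for n
  proof -
    have "(\<integral>\<^sup>+v. ennreal (\<Phi> n x v) \<partial>lborel) \<le> ennreal (1 / h n) * ennreal (indicator {a..b - h n} x * (U (x + h n) - U x))" for x
    proof (cases "x \<in> {a..b - h n}")
      case True
      then have x: "x \<in> \<Theta>" "x + h n \<in> \<Theta>" "x \<le> x + h n" using ab h[of n] by auto
      define k where "k v = p x v * (cdf (G x) v - cdf (G (x + h n)) v)" for v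
      have "set_integrable lborel V (\<lambda>v. p x v * cdf (G x) v - p x v * cdf (G (x + h n)) v)"
        using x mono by (intro set_integral_diff set_integrable_mono_on_cdf_G) auto
      then have int: "integrable lborel (\<lambda>v. indicator V v * k v)"
        by (simp add: set_integrable_def k_def right_diff_distrib)
      have "(\<integral>\<^sup>+v. ennreal (\<Phi> n x v) \<partial>lborel) = (\<integral>\<^sup>+v. ennreal (indicator V v * k v / h n) \<partial>lborel)"
        by (subst \<Phi>_eq[OF True]) (simp add: k_def)
      also have "\<dots> = ennreal ((LINT v|lborel. indicator V v * k v) / h n)"
        using int quot_nonneg[OF x] h[of n]
        by (subst nn_integral_eq_integral) (auto simp: k_def)
      also have "\<dots> \<le> ennreal ((U (x + h n) - U x) / h n)"
        using U[OF x] h[of n] by (intro ennreal_leI divide_right_mono) (auto simp: set_lebesgue_integral_def k_def)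
      also have "\<dots> = ennreal (1 / h n) * ennreal (U (x + h n) - U x)"
        using h[of n] by (subst ennreal_mult'[symmetric]) auto
      finally show ?thesis using True by simp
    qed (simp add: \<Phi>_def)
    then have "(\<integral>\<^sup>+x. (\<integral>\<^sup>+v. ennreal (\<Phi> n x v) \<partial>lborel) \<partial>lborel) \<le>
      (\<integral>\<^sup>+x. ennreal (1 / h n) * ennreal (indicator {a..b - h n} x * (U (x + h n) - U x)) \<partial>lborel)"
      by (intro nn_integral_mono)
    also have "\<dots> = ennreal (1 / h n) * (\<integral>\<^sup>+x. ennreal (indicator {a..b - h n} x * (U (x + h n) - U x)) \<partial>lborel)"
    proof (rule nn_integral_cmult)
      have "mono_on {a..b - h n} (\<lambda>x. U (x + h n))" "mono_on {a..b - h n} U"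
        using h[of n] by (auto intro!: mono_onI mono_onD[OF U_mono])
      then have "set_integrable lborel {a..b - h n} (\<lambda>x. U (x + h n) - U x)"
        by (intro set_integral_diff set_integrable_mono_on)
      then show "(\<lambda>x. ennreal (indicator {a..b - h n} x * (U (x + h n) - U x))) \<in> borel_measurable lborel"
        by (auto simp: set_integrable_def)
    qed
    also have "\<dots> \<le> ennreal (1 / h n) * ennreal (h n * (U b - U a))"
      using nn_integral_increment_le[OF U_mono h] by (rule mult_left_mono) simp
    also have "\<dots> = ennreal (U b - U a)"
      using h[of n] by (subst ennreal_mult'[symmetric]) auto
    finally show ?thesis .
  qed
  \<comment> \<open>Fatou is needed twice, first in \<open>v\<close> for each fixed \<open>x\<close>
    other than \<open>b\<close>, then in \<open>x\<close>.\<close>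
  have "(\<integral>\<^sup>+x. (\<integral>\<^sup>+v. ennreal (indicator {a..b} x * (p x v * decline x v)) \<partial>lborel) \<partial>lborel) \<le>
    (\<integral>\<^sup>+x. liminf (\<lambda>n. \<integral>\<^sup>+v. ennreal (\<Phi> n x v) \<partial>lborel) \<partial>lborel)"
  proof (rule nn_integral_mono_AE, rule AE_mp[OF AE_lborel_singleton[of b]], intro AE_I2 impI)
    fix x assume "x \<noteq> b"
    then have "ennreal (indicator {a..b} x * (p x v * decline x v)) = liminf (\<lambda>n. ennreal (\<Phi> n x v))" for v
      by (intro lim_imp_Liminf[symmetric] tendsto_ennrealI lim) auto
    then show "(\<integral>\<^sup>+v. ennreal (indicator {a..b} x * (p x v * decline x v)) \<partial>lborel) \<le>
        liminf (\<lambda>n. \<integral>\<^sup>+v. ennreal (\<Phi> n x v) \<partial>lborel)"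
      by (simp add: nn_integral_liminf)
  qed
  also have "\<dots> \<le> liminf (\<lambda>n. \<integral>\<^sup>+x. (\<integral>\<^sup>+v. ennreal (\<Phi> n x v) \<partial>lborel) \<partial>lborel)"
    by (rule nn_integral_liminf) measurable
  also have "\<dots> \<le> ennreal (U b - U a)"
    using bound by (intro Liminf_le) auto
  finally show ?thesis .
qed

subsection \<open>Expected profit\<close>

lemma set_borel_measurable_section:
  assumes h: "set_borel_measurable borel (\<Theta> \<times> V) (\<lambda>(\<theta>, v). h \<theta> v :: real)" and \<theta>: "\<theta> \<in> \<Theta>"
  shows "set_borel_measurable borel V (h \<theta>)"
proof -
  have [measurable]: "(\<lambda>z. indicator (\<Theta> \<times> V) z *\<^sub>R (case z of (\<theta>, v) \<Rightarrow> h \<theta> v)) \<in> borel_measurable (borel \<Otimes>\<^sub>M borel)"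
    using h by (simp add: set_borel_measurable_def borel_prod)
  have "(\<lambda>v. (\<lambda>z. indicator (\<Theta> \<times> V) z *\<^sub>R (case z of (\<theta>, v) \<Rightarrow> h \<theta> v)) (\<theta>, v)) \<in> borel_measurable borel"
    by measurable
  also have "(\<lambda>v. (\<lambda>z. indicator (\<Theta> \<times> V) z *\<^sub>R (case z of (\<theta>, v) \<Rightarrow> h \<theta> v)) (\<theta>, v)) = (\<lambda>v. indicator V v *\<^sub>R h \<theta> v)"
    using \<theta> by (auto split: split_indicator)
  finally show ?thesis by (simp add: set_borel_measurable_def)
qed

lemma borel_measurable_weighted:
  assumes h: "set_borel_measurable borel (\<Theta> \<times> V) (\<lambda>(\<theta>, v). h \<theta> v :: real)"
  shows "(\<lambda>(\<theta>, v). indicator \<Theta> \<theta> * (indicator V v * (g \<theta> v * h \<theta> v))) \<in> borel_measurable (borel \<Otimes>\<^sub>M borel)"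
proof -
  have [measurable]: "(\<lambda>z. indicator (\<Theta> \<times> V) z *\<^sub>R (case z of (\<theta>, v) \<Rightarrow> h \<theta> v)) \<in> borel_measurable (borel \<Otimes>\<^sub>M borel)"
    "(\<lambda>z. indicator (\<Theta> \<times> V) z *\<^sub>R (case z of (\<theta>, v) \<Rightarrow> g \<theta> v)) \<in> borel_measurable (borel \<Otimes>\<^sub>M borel)"
    using h g_meas by (simp_all add: set_borel_measurable_def borel_prod)
  have "(\<lambda>z. (indicator (\<Theta> \<times> V) z *\<^sub>R (case z of (\<theta>, v) \<Rightarrow> h \<theta> v)) * (indicator (\<Theta> \<times> V) z *\<^sub>R (case z of (\<theta>, v) \<Rightarrow> g \<theta> v)))
    \<in> borel_measurable (borel \<Otimes>\<^sub>M borel)"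
    by measurable
  also have "(\<lambda>z. (indicator (\<Theta> \<times> V) z *\<^sub>R (case z of (\<theta>, v) \<Rightarrow> h \<theta> v)) * (indicator (\<Theta> \<times> V) z *\<^sub>R (case z of (\<theta>, v) \<Rightarrow> g \<theta> v)))
    = (\<lambda>(\<theta>, v). indicator \<Theta> \<theta> * (indicator V v * (g \<theta> v * h \<theta> v)))"
    by (auto split: split_indicator)
  finally show ?thesis .
qed

lemma set_borel_measurable_interim:
  fixes h :: "real \<Rightarrow> real \<Rightarrow> real"
  assumes h: "set_borel_measurable borel (\<Theta> \<times> V) (\<lambda>(\<theta>, v). h \<theta> v)"
  shows "set_borel_measurable borel \<Theta> (\<lambda>\<theta>. LINT v:V|G \<theta>. h \<theta> v)"
proof -
  note [measurable] = borel_measurable_weighted[OF h]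
  have "(\<lambda>\<theta>. indicator \<Theta> \<theta> *\<^sub>R (LINT v:V|G \<theta>. h \<theta> v)) =
    (\<lambda>\<theta>. LINT v|lborel. indicator \<Theta> \<theta> * (indicator V v * (g \<theta> v * h \<theta> v)))"
    using set_integral_has_pos_density_on[OF G _ set_borel_measurable_section[OF h]]
    by (auto simp: set_lebesgue_integral_def split: split_indicator)
  also have "\<dots> \<in> borel_measurable borel" by measurable
  finally show ?thesis by (simp add: set_borel_measurable_def)
qed

lemma borel_measurable_joint_density:
  "(\<lambda>(\<theta>, v). indicator (\<Theta> \<times> V) (\<theta>, v) * (f \<theta> * g \<theta> v)) \<in> borel_measurable (borel \<Otimes>\<^sub>M borel)"
  and joint_density_nonneg: "0 \<le> indicator (\<Theta> \<times> V) (\<theta>, v) * (f \<theta> * g \<theta> v)"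
proof -
  have [measurable]: "(\<lambda>\<theta>. indicator \<Theta> \<theta> * f \<theta>) \<in> borel_measurable borel"
    "(\<lambda>z. indicator (\<Theta> \<times> V) z *\<^sub>R (case z of (\<theta>, v) \<Rightarrow> g \<theta> v)) \<in> borel_measurable (borel \<Otimes>\<^sub>M borel)"
    using has_pos_density_onD(4)[OF F] g_meas by (simp_all add: set_borel_measurable_def borel_prod)
  have "(\<lambda>z. (indicator \<Theta> (fst z) * f (fst z)) * (indicator (\<Theta> \<times> V) z *\<^sub>R (case z of (\<theta>, v) \<Rightarrow> g \<theta> v)))
    \<in> borel_measurable (borel \<Otimes>\<^sub>M borel)"
    by measurable
  also have "(\<lambda>z. (indicator \<Theta> (fst z) * f (fst z)) * (indicator (\<Theta> \<times> V) z *\<^sub>R (case z of (\<theta>, v) \<Rightarrow> g \<theta> v)))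
     = (\<lambda>(\<theta>, v). indicator (\<Theta> \<times> V) (\<theta>, v) * (f \<theta> * g \<theta> v))"
    by (auto split: split_indicator)
  finally show "(\<lambda>(\<theta>, v). indicator (\<Theta> \<times> V) (\<theta>, v) * (f \<theta> * g \<theta> v)) \<in> borel_measurable (borel \<Otimes>\<^sub>M borel)" .
  show "0 \<le> indicator (\<Theta> \<times> V) (\<theta>, v) * (f \<theta> * g \<theta> v)"
    using F G by (auto simp: has_pos_density_on_def less_imp_le split: split_indicator)
qed

lemma joint_dist_eq:
  "joint_dist \<Theta> V f g = density (lborel \<Otimes>\<^sub>M lborel) (\<lambda>z. ennreal (case z of (\<theta>, v) \<Rightarrow> indicator (\<Theta> \<times> V) (\<theta>, v) * (f \<theta> * g \<theta> v)))"
  by (simp add: joint_dist_def lborel_prod split_beta')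

lemma emeasure_joint_dist_finite: "emeasure (joint_dist \<Theta> V f g) (\<Theta> \<times> V) < \<infinity>"
proof -
  note [measurable] = borel_measurable_joint_density
  interpret F: prob_space F by (rule prob_F)
  have [measurable]: "(\<lambda>\<theta>. indicator \<Theta> \<theta> * f \<theta>) \<in> borel_measurable borel"
    using has_pos_density_onD(4)[OF F] by simp
  have "emeasure (joint_dist \<Theta> V f g) (\<Theta> \<times> V) =
    (\<integral>\<^sup>+z. ennreal (case z of (\<theta>, v) \<Rightarrow> indicator (\<Theta> \<times> V) (\<theta>, v) * (f \<theta> * g \<theta> v)) * indicator (\<Theta> \<times> V) z \<partial>(lborel \<Otimes>\<^sub>M lborel))"
    unfolding joint_dist_eq by (rule emeasure_density) measurable
  also have "\<dots> = (\<integral>\<^sup>+z. ennreal (case z of (\<theta>, v) \<Rightarrow> indicator (\<Theta> \<times> V) (\<theta>, v) * (f \<theta> * g \<theta> v)) \<partial>(lborel \<Otimes>\<^sub>M lborel))"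
  proof (intro nn_integral_cong)
    fix z :: "real \<times> real"
    show "ennreal (case z of (\<theta>, v) \<Rightarrow> indicator (\<Theta> \<times> V) (\<theta>, v) * (f \<theta> * g \<theta> v)) * indicator (\<Theta> \<times> V) z =
      ennreal (case z of (\<theta>, v) \<Rightarrow> indicator (\<Theta> \<times> V) (\<theta>, v) * (f \<theta> * g \<theta> v))"
      by (cases "z \<in> \<Theta> \<times> V") (simp_all add: split_beta')
  qed
  also have "\<dots> = (\<integral>\<^sup>+\<theta>. (\<integral>\<^sup>+v. ennreal (indicator (\<Theta> \<times> V) (\<theta>, v) * (f \<theta> * g \<theta> v)) \<partial>lborel) \<partial>lborel)"
    by (subst lborel.nn_integral_fst[symmetric]) auto
  also have "\<dots> = (\<integral>\<^sup>+\<theta>. ennreal (indicator \<Theta> \<theta> * f \<theta>) \<partial>lborel)"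
  proof (intro nn_integral_cong)
    fix \<theta> :: real
    show "(\<integral>\<^sup>+v. ennreal (indicator (\<Theta> \<times> V) (\<theta>, v) * (f \<theta> * g \<theta> v)) \<partial>lborel) = ennreal (indicator \<Theta> \<theta> * f \<theta>)"
    proof (cases "\<theta> \<in> \<Theta>")
      case True
      note M = has_pos_density_onD[OF G[OF True], simplified]
      interpret Gt: prob_space "G \<theta>" by (rule prob_G[OF True])
      have "1 = emeasure (G \<theta>) UNIV" using Gt.emeasure_space_1 M by simp
      also have "\<dots> = (\<integral>\<^sup>+v. ennreal (indicator V v * g \<theta> v) \<partial>lborel)"
        using M by (subst has_pos_density_on_density[OF G[OF True]]; simp add: emeasure_density)
      finally have 1: "(\<integral>\<^sup>+v. ennreal (indicator V v * g \<theta> v) \<partial>lborel) = 1" by simp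
      have "0 \<le> f \<theta>" using F True by (auto simp: has_pos_density_on_def less_imp_le)
      then have "(\<integral>\<^sup>+v. ennreal (indicator (\<Theta> \<times> V) (\<theta>, v) * (f \<theta> * g \<theta> v)) \<partial>lborel) =
         (\<integral>\<^sup>+v. ennreal (f \<theta>) * ennreal (indicator V v * g \<theta> v) \<partial>lborel)"
        using True by (intro nn_integral_cong) (auto simp: ennreal_mult' split: split_indicator)
      also have "\<dots> = ennreal (f \<theta>) * 1"
        using M by (subst nn_integral_cmult) (auto simp: 1)
      finally show ?thesis using True by simp
    next
      case False
      then have "indicator (\<Theta> \<times> V) (\<theta>, v) = (0 :: real)" for v
        by (auto simp: indicator_def)
      with False show ?thesis by simp
    qed
  qed
  also have "\<dots> = emeasure F UNIV"
    by (subst has_pos_density_on_density[OF F]; simp add: emeasure_density)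
  finally show ?thesis using F.emeasure_finite[of UNIV] by (simp add: less_top[symmetric])
qed

text \<open>Disintegration of the joint law into signal and conditional value. Signals at which the
  inner integrand is not integrable form a null set by Fubini, so the default value 0 there is
  harmless.\<close>

lemma
  fixes h :: "real \<Rightarrow> real \<Rightarrow> real"
  assumes h: "set_borel_measurable borel (\<Theta> \<times> V) (\<lambda>(\<theta>, v). h \<theta> v)"
    and int: "set_integrable (joint_dist \<Theta> V f g) (\<Theta> \<times> V) (\<lambda>(\<theta>, v). h \<theta> v)"
  shows set_integrable_interim: "set_integrable F \<Theta> (\<lambda>\<theta>. LINT v:V|G \<theta>. h \<theta> v)"
    and set_integral_joint_dist: "(LINT (\<theta>, v):\<Theta> \<times> V|joint_dist \<Theta> V f g. h \<theta> v) = (LINT \<theta>:\<Theta>|F. LINT v:V|G \<theta>. h \<theta> v)"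
proof -
  note [measurable] = borel_measurable_joint_density
  have [measurable]: "(\<lambda>z. indicator (\<Theta> \<times> V) z *\<^sub>R (case z of (\<theta>, v) \<Rightarrow> h \<theta> v)) \<in> borel_measurable (borel \<Otimes>\<^sub>M borel)"
    using h by (simp add: set_borel_measurable_def borel_prod)
  define H where "H \<theta> v = indicator \<Theta> \<theta> * f \<theta> * (indicator V v * (g \<theta> v * h \<theta> v))" for \<theta> v
  have H: "(\<lambda>z. (case z of (\<theta>, v) \<Rightarrow> indicator (\<Theta> \<times> V) (\<theta>, v) * (f \<theta> * g \<theta> v)) *\<^sub>R (indicator (\<Theta> \<times> V) z *\<^sub>R (case z of (\<theta>, v) \<Rightarrow> h \<theta> v)))
     = (\<lambda>(\<theta>, v). H \<theta> v)"
    by (auto simp: H_def split: split_indicator)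
  have nn: "AE z in lborel \<Otimes>\<^sub>M lborel. 0 \<le> (case z of (\<theta>, v) \<Rightarrow> indicator (\<Theta> \<times> V) (\<theta>, v) * (f \<theta> * g \<theta> v))"
    by (intro AE_I2) (auto intro: joint_density_nonneg simp del: indicator_simps split: prod.split)
  have intH: "integrable (lborel \<Otimes>\<^sub>M lborel) (\<lambda>(\<theta>, v). H \<theta> v)"
    using int unfolding set_integrable_def joint_dist_eq
    by (subst (asm) integrable_density[OF _ _ nn]) (simp_all only: H, measurable)
  have eqH: "(LINT (\<theta>, v):\<Theta> \<times> V|joint_dist \<Theta> V f g. h \<theta> v) = (LINT z|(lborel \<Otimes>\<^sub>M lborel). (case z of (\<theta>, v) \<Rightarrow> H \<theta> v))"
    unfolding set_lebesgue_integral_def joint_dist_eq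
    by (subst integral_density[OF _ _ nn]) (simp_all only: H, measurable)
  have fst: "(LINT v|lborel. H \<theta> v) = indicator \<Theta> \<theta> *\<^sub>R (f \<theta> * (LINT v:V|G \<theta>. h \<theta> v))" for \<theta>
  proof (cases "\<theta> \<in> \<Theta>")
    case True
    then show ?thesis
      using set_integral_has_pos_density_on[OF G _ set_borel_measurable_section[OF h], of \<theta>]
      by (simp add: H_def[abs_def] set_lebesgue_integral_def)
  qed (simp add: H_def[abs_def])
  have "integrable lborel (\<lambda>\<theta>. LINT v|lborel. H \<theta> v)"
    using lborel_pair.integrable_fst[OF intH] .
  then show "set_integrable F \<Theta> (\<lambda>\<theta>. LINT v:V|G \<theta>. h \<theta> v)"
    unfolding fst
    by (subst set_integrable_has_pos_density_on_iff[OF F _ set_borel_measurable_interim[OF h]])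
       (simp_all add: set_integrable_def)
  have "(LINT (\<theta>, v):\<Theta> \<times> V|joint_dist \<Theta> V f g. h \<theta> v) = (LINT \<theta>|lborel. LINT v|lborel. H \<theta> v)"
    unfolding eqH using lborel_pair.integral_fst[OF intH] by simp
  then show "(LINT (\<theta>, v):\<Theta> \<times> V|joint_dist \<Theta> V f g. h \<theta> v) = (LINT \<theta>:\<Theta>|F. LINT v:V|G \<theta>. h \<theta> v)"
    unfolding fst
    by (subst set_integral_has_pos_density_on[OF F _ set_borel_measurable_interim[OF h]])
       (simp_all add: set_lebesgue_integral_def)
qed

section \<open>Mechanisms obeying the envelope formula, and their profit\<close>

abbreviation gain :: "(real \<Rightarrow> real \<Rightarrow> real) \<Rightarrow> real \<Rightarrow> real \<Rightarrow> real" where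
  "gain q \<equiv> \<lambda>\<theta> v. q \<theta> v powr \<alpha>"

abbreviation util :: "(real \<Rightarrow> real \<Rightarrow> real) \<Rightarrow> (real \<Rightarrow> real \<Rightarrow> real) \<Rightarrow> real \<Rightarrow> real \<Rightarrow> real" where
  "util q t \<equiv> \<lambda>\<theta> v. buyer_util \<alpha> v (q \<theta> v) (t \<theta> v)"

abbreviation interim :: "(real \<Rightarrow> real \<Rightarrow> real) \<Rightarrow> (real \<Rightarrow> real \<Rightarrow> real) \<Rightarrow> real \<Rightarrow> real \<Rightarrow> real" where
  "interim \<equiv> interim_util \<alpha> V G"

definition surplus :: "(real \<Rightarrow> real \<Rightarrow> real) \<Rightarrow> real \<Rightarrow> real" where
  "surplus q \<theta> = (LINT v:V|G \<theta>. v * gain q \<theta> v - c * q \<theta> v)"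

text \<open>Collects what the accounting of profit takes from (IC1). It is separate from
  \<open>feasible\<close> because the same accounting is applied to \<open>q_star\<close> before
  (IC0) is established for it, and in order to establish it.\<close>

definition envelope_mechanism :: "(real \<Rightarrow> real \<Rightarrow> real) \<Rightarrow> (real \<Rightarrow> real \<Rightarrow> real) \<Rightarrow> bool" where
  "envelope_mechanism q t \<longleftrightarrow>
     (\<forall>\<theta>\<in>\<Theta>. \<forall>v\<in>V. 0 \<le> q \<theta> v) \<and>
     set_borel_measurable borel (\<Theta> \<times> V) (\<lambda>(\<theta>, v). q \<theta> v) \<and>
     set_borel_measurable borel (\<Theta> \<times> V) (\<lambda>(\<theta>, v). t \<theta> v) \<and>
     (\<forall>\<theta>\<in>\<Theta>. mono_on V (gain q \<theta>)) \<and>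
     (\<forall>\<theta>\<in>\<Theta>. \<forall>v\<in>V. util q t \<theta> v = util q t \<theta> vl + (LINT x:{vl..v}|lborel. gain q \<theta> x))"

lemma envelope_mechanismD:
  assumes "envelope_mechanism q t"
  shows "\<And>\<theta> v. \<theta> \<in> \<Theta> \<Longrightarrow> v \<in> V \<Longrightarrow> 0 \<le> q \<theta> v"
    "set_borel_measurable borel (\<Theta> \<times> V) (\<lambda>(\<theta>, v). q \<theta> v)"
    "set_borel_measurable borel (\<Theta> \<times> V) (\<lambda>(\<theta>, v). t \<theta> v)"
    "\<And>\<theta>. \<theta> \<in> \<Theta> \<Longrightarrow> mono_on V (gain q \<theta>)"
    "\<And>\<theta> v. \<theta> \<in> \<Theta> \<Longrightarrow> v \<in> V \<Longrightarrow> util q t \<theta> v = util q t \<theta> vl + (LINT x:{vl..v}|lborel. gain q \<theta> x)"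
  using assms unfolding envelope_mechanism_def by blast+

text \<open>Value \<open>v\<close> reporting \<open>w\<close> obtains the utility of
  \<open>w\<close> plus \<open>v - w\<close> times q^\<alpha> at \<open>w\<close>, since utility is
  linear in the value. (IC1) is thus the subgradient inequality treated above.\<close>

lemma feasible_envelope_mechanism:
  assumes "feasible \<alpha> c \<Theta> V f g G q t"
  shows "envelope_mechanism q t"
proof -
  have IC1: "IC1 \<alpha> \<Theta> V q t" using assms by (simp add: feasible_def)
  have slope: "(v - w) * gain q \<theta> w \<le> util q t \<theta> v - util q t \<theta> w"
    if "\<theta> \<in> \<Theta>" "v \<in> V" "w \<in> V" for \<theta> v w
    using IC1[unfolded IC1_def, rule_format, OF that] by (simp add: buyer_util_def algebra_simps)
  have "mono_on V (gain q \<theta>)" if "\<theta> \<in> \<Theta>" for \<theta>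
    by (rule slope_sandwich_mono_on[where u = "util q t \<theta>"]) (rule slope[OF that])
  moreover have "util q t \<theta> v = util q t \<theta> vl + (LINT x:{vl..v}|lborel. gain q \<theta> x)"
    if "\<theta> \<in> \<Theta>" "v \<in> V" for \<theta> v
    by (rule slope_sandwich_integral[where u = "util q t \<theta>", OF slope[OF that(1)] that(2)])
  ultimately show ?thesis
    using assms unfolding envelope_mechanism_def feasible_def by blast
qed

lemma mono_on_quantity:
  assumes "\<And>v. v \<in> V \<Longrightarrow> 0 \<le> q \<theta> v" "mono_on V (gain q \<theta>)"
  shows "mono_on V (q \<theta>)"
proof (rule mono_onI)
  fix v w assume *: "v \<in> V" "w \<in> V" "v \<le> w"
  show "q \<theta> v \<le> q \<theta> w"
  proof (rule ccontr)
    assume "\<not> q \<theta> v \<le> q \<theta> w"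
    then have "gain q \<theta> w < gain q \<theta> v"
      using assms(1)[of w] alpha * by (intro powr_less_mono2) auto
    then show False using mono_onD[OF assms(2) *] by simp
  qed
qed

lemma set_integrable_surplus:
  assumes \<theta>: "\<theta> \<in> \<Theta>" and nonneg: "\<And>v. v \<in> V \<Longrightarrow> 0 \<le> q \<theta> v" and mono: "mono_on V (gain q \<theta>)"
  shows "set_borel_measurable borel V (\<lambda>v. v * gain q \<theta> v - c * q \<theta> v)" (is ?meas)
    and "set_integrable (G \<theta>) V (\<lambda>v. v * gain q \<theta> v - c * q \<theta> v)" (is ?int)
proof -
  interpret prob_space "G \<theta>" using prob_G[OF \<theta>] .
  note s[simp] = has_pos_density_onD(2,3)[OF G[OF \<theta>], simplified]
  have mono_q: "mono_on V (q \<theta>)" using mono_on_quantity[of q \<theta>, OF nonneg mono] .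
  note [measurable] = borel_measurable_mono_on_fnc[OF mono_q]
  have [measurable]: "(\<lambda>x. x) \<in> borel_measurable (restrict_space borel V)"
    by (rule measurable_restrict_space1) simp
  show meas: ?meas
    by (subst set_borel_measurable_restrict_space_iff) (simp, measurable)
  show ?int
  proof (rule set_integrable_bounded)
    show "set_borel_measurable (G \<theta>) V (\<lambda>v. v * gain q \<theta> v - c * q \<theta> v)"
      using meas s(1) unfolding set_borel_measurable_def by (simp cong: measurable_cong_sets)
    show "emeasure (G \<theta>) V < \<infinity>" using emeasure_finite[of V] by (simp add: less_top[symmetric])
    fix v assume v: "v \<in> V"
    have "\<bar>v * gain q \<theta> v - c * q \<theta> v\<bar> \<le> \<bar>v * gain q \<theta> v\<bar> + \<bar>c * q \<theta> v\<bar>" by linarith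
    also have "\<dots> \<le> (\<bar>vl\<bar> + \<bar>vh\<bar>) * (\<bar>gain q \<theta> vl\<bar> + \<bar>gain q \<theta> vh\<bar>) + c * (\<bar>q \<theta> vl\<bar> + \<bar>q \<theta> vh\<bar>)"
      unfolding abs_mult using cost v abs_le_mono_on[OF mono v] abs_le_mono_on[OF mono_q v]
      by (intro add_mono mult_mono) auto
    finally show "\<bar>v * gain q \<theta> v - c * q \<theta> v\<bar> \<le> \<dots>" .
  qed simp
qed

lemma interim_profit:
  assumes em: "envelope_mechanism q t" and \<theta>: "\<theta> \<in> \<Theta>"
  shows "(LINT v:V|G \<theta>. t \<theta> v - q \<theta> v * c) = surplus q \<theta> - interim q t \<theta> \<theta>"
proof -
  note E = envelope_mechanismD[OF em]
  have u: "set_integrable (G \<theta>) V (util q t \<theta>)"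
    by (rule set_integrable_envelope[OF E(4)[OF \<theta>] \<theta> E(5)[OF \<theta>]])
  have "(LINT v:V|G \<theta>. t \<theta> v - q \<theta> v * c) =
      (LINT v:V|G \<theta>. (v * gain q \<theta> v - c * q \<theta> v) - util q t \<theta> v)"
    by (simp add: buyer_util_def algebra_simps)
  also have "\<dots> = surplus q \<theta> - (LINT v:V|G \<theta>. util q t \<theta> v)"
    unfolding surplus_def
    by (rule set_integral_diff(2)[OF set_integrable_surplus(2)[of \<theta> q, OF \<theta> E(1)[OF \<theta>] E(4)[OF \<theta>]] u])
  finally show ?thesis by (simp add: interim_util_def)
qed

lemma interim_eq:
  assumes em: "envelope_mechanism q t" and "\<theta> \<in> \<Theta>" "\<theta>' \<in> \<Theta>"
  shows "interim q t \<theta> \<theta>' = util q t \<theta>' vl + (LINT x:V|lborel. gain q \<theta>' x * (1 - cdf (G \<theta>) x))"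
  unfolding interim_util_def
  by (rule set_integral_envelope[OF envelope_mechanismD(4)[OF em assms(3)] assms(2) envelope_mechanismD(5)[OF em assms(3)]])

text \<open>Two signals sending the same report share the utility at \<open>vl\<close>, so only the
  difference of their distribution functions remains. This is the form in which (IC0) is both
  exploited and verified.\<close>

lemma interim_diff:
  assumes em: "envelope_mechanism q t" and "\<theta> \<in> \<Theta>" "\<theta>' \<in> \<Theta>"
  shows "interim q t \<theta> \<theta>' - interim q t \<theta>' \<theta>' =
    (LINT x:V|lborel. gain q \<theta>' x * (cdf (G \<theta>') x - cdf (G \<theta>) x))"
proof -
  have mono: "mono_on V (gain q \<theta>')" using envelope_mechanismD(4)[OF em assms(3)] .
  have i: "set_integrable lborel V (\<lambda>x. gain q \<theta>' x * (1 - cdf (G y) x))" if "y \<in> \<Theta>" for y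
    using set_integrable_tail[OF G[OF that] set_integrable_mono_on[OF mono]] .
  show ?thesis
    using assms i
    by (simp add: interim_eq set_integral_diff(2)[symmetric] algebra_simps)
qed

text \<open>Integrability of profit alone does not allow its integral to be split. Given that
  interim utility is integrable, surplus is too, as the sum of interim profit and interim
  utility.\<close>

lemma profit_eq:
  assumes em: "envelope_mechanism q t"
    and int: "set_integrable (joint_dist \<Theta> V f g) (\<Theta> \<times> V) (\<lambda>(\<theta>, v). t \<theta> v - q \<theta> v * c)"
    and U: "set_integrable F \<Theta> (\<lambda>\<theta>. interim q t \<theta> \<theta>)"
  shows "set_integrable F \<Theta> (surplus q)"
    and "expected_profit c \<Theta> V f g q t = (LINT \<theta>:\<Theta>|F. surplus q \<theta>) - (LINT \<theta>:\<Theta>|F. interim q t \<theta> \<theta>)"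
proof -
  note E = envelope_mechanismD[OF em]
  have meas: "set_borel_measurable borel (\<Theta> \<times> V) (\<lambda>(\<theta>, v). t \<theta> v - q \<theta> v * c)"
    using E(2,3) by (subst set_borel_measurable_restrict_space_iff; simp add: set_borel_measurable_restrict_space_iff borel_Times split_beta')
  have P: "set_integrable F \<Theta> (\<lambda>\<theta>. surplus q \<theta> - interim q t \<theta> \<theta>)"
    using set_integrable_interim[OF meas int] interim_profit[OF em]
    by (subst (asm) set_integrable_cong[OF refl refl]) auto
  have "set_integrable F \<Theta> (\<lambda>\<theta>. (surplus q \<theta> - interim q t \<theta> \<theta>) + interim q t \<theta> \<theta>)"
    by (rule set_integral_add(1)[OF P U])
  then show S: "set_integrable F \<Theta> (surplus q)" by simp
  have "expected_profit c \<Theta> V f g q t = (LINT \<theta>:\<Theta>|F. surplus q \<theta> - interim q t \<theta> \<theta>)"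
    unfolding expected_profit_def set_integral_joint_dist[OF meas int]
    using interim_profit[OF em] sets_F by (intro set_lebesgue_integral_cong) auto
  then show "expected_profit c \<Theta> V f g q t = (LINT \<theta>:\<Theta>|F. surplus q \<theta>) - (LINT \<theta>:\<Theta>|F. interim q t \<theta> \<theta>)"
    by (simp add: set_integral_diff(2)[OF S U])
qed

section \<open>Virtual surplus\<close>

lemma
  assumes int: "integrable (lborel \<Otimes>\<^sub>M lborel) (\<lambda>(x, v). p x v * decline x v)"
  shows set_integrable_rent: "A \<in> sets borel \<Longrightarrow> set_integrable lborel A (rent p)"
    and AE_integrable_rent: "AE x in lborel. integrable lborel (\<lambda>v. p x v * decline x v)"
  using lborel_pair.integrable_fst[OF int] lborel_pair.AE_integrable_fst[OF int]
    integrable_mult_indicator[of A lborel "rent p"]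
  by (auto simp: rent_def[abs_def] set_integrable_def)

lemma set_integral_rent:
  assumes int: "integrable (lborel \<Otimes>\<^sub>M lborel) (\<lambda>(x, v). p x v * decline x v)" and A: "A \<in> sets borel"
  shows "(LINT x:A|lborel. rent p x) = (LINT z|(lborel \<Otimes>\<^sub>M lborel). indicator A (fst z) * (p (fst z) (snd z) * decline (fst z) (snd z)))"
    and "integrable (lborel \<Otimes>\<^sub>M lborel) (\<lambda>z. indicator A (fst z) * (p (fst z) (snd z) * decline (fst z) (snd z)))"
proof -
  have "integrable (lborel \<Otimes>\<^sub>M lborel) (\<lambda>z. indicator (A \<times> UNIV) z *\<^sub>R (case z of (x, v) \<Rightarrow> p x v * decline x v))"
    using A by (intro integrable_mult_indicator[OF _ int]) auto
  then show i: "integrable (lborel \<Otimes>\<^sub>M lborel) (\<lambda>z. indicator A (fst z) * (p (fst z) (snd z) * decline (fst z) (snd z)))"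
    by (simp add: indicator_times split_beta')
  show "(LINT x:A|lborel. rent p x) = (LINT z|(lborel \<Otimes>\<^sub>M lborel). indicator A (fst z) * (p (fst z) (snd z) * decline (fst z) (snd z)))"
    using lborel_pair.integral_fst'[OF i] by (simp add: set_lebesgue_integral_def rent_def)
qed

text \<open>An integrand for Lebesgue measure, already weighted by \<open>f\<close>. The virtual
  value is hidden in it: \<open>virtual_surplus_eq\<close> brings it out at signals where the
  section of the rent is integrable.\<close>

definition virtual_surplus :: "(real \<Rightarrow> real \<Rightarrow> real) \<Rightarrow> real \<Rightarrow> real" where
  "virtual_surplus q \<theta> = f \<theta> * surplus q \<theta> - rent (gain q) \<theta> * (1 - cdf F \<theta>)"

text \<open>Rent accrued up to \<theta> is paid to all higher signals as well; exchanging the two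
  integrations over signals charges \<open>rent\<close> at \<theta> with the mass
  \<open>1 - cdf F \<theta>\<close> above it.\<close>

lemma
  assumes q: "set_borel_measurable borel (\<Theta> \<times> V) (\<lambda>(\<theta>, v). q \<theta> v)"
    and S: "set_integrable F \<Theta> (surplus q)"
    and int: "integrable (lborel \<Otimes>\<^sub>M lborel) (\<lambda>(x, v). gain q x v * decline x v)"
  shows set_integrable_virtual_surplus: "set_integrable lborel \<Theta> (virtual_surplus q)"
    and set_integral_virtual_surplus: "(LINT \<theta>:\<Theta>|lborel. virtual_surplus q \<theta>) =
      (LINT \<theta>:\<Theta>|F. surplus q \<theta>) - (LINT \<theta>:\<Theta>|F. LINT x:{\<theta>l..\<theta>}|lborel. rent (gain q) x)"
proof -
  have meas: "set_borel_measurable borel (\<Theta> \<times> V) (\<lambda>(\<theta>, v). v * gain q \<theta> v - c * q \<theta> v)"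
  proof -
    have [measurable]: "(\<lambda>z. q (fst z) (snd z)) \<in> borel_measurable (restrict_space borel (\<Theta> \<times> V))"
      using q by (simp add: set_borel_measurable_restrict_space_iff borel_Times split_beta')
    have [measurable]: "snd \<in> borel_measurable (restrict_space borel (\<Theta> \<times> V))"
      by (intro measurable_restrict_space1) (simp flip: borel_prod)
    show ?thesis
      by (subst set_borel_measurable_restrict_space_iff) (simp_all add: borel_Times split_beta')
  qed
  have mS: "set_borel_measurable borel \<Theta> (surplus q)"
    using set_borel_measurable_interim[OF meas] by (simp add: surplus_def[abs_def])
  have fS: "set_integrable lborel \<Theta> (\<lambda>\<theta>. f \<theta> * surplus q \<theta>)"
    using S set_integrable_has_pos_density_on_iff[OF F _ mS] by simp
  have R: "set_integrable lborel \<Theta> (rent (gain q))"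
    by (rule set_integrable_rent[OF int]) simp
  note T = set_integrable_tail[OF F R]
  show "set_integrable lborel \<Theta> (virtual_surplus q)"
    unfolding virtual_surplus_def[abs_def] by (rule set_integral_diff(1)[OF fS T])
  show "(LINT \<theta>:\<Theta>|lborel. virtual_surplus q \<theta>) =
      (LINT \<theta>:\<Theta>|F. surplus q \<theta>) - (LINT \<theta>:\<Theta>|F. LINT x:{\<theta>l..\<theta>}|lborel. rent (gain q) x)"
    unfolding virtual_surplus_def set_integral_diff(2)[OF fS T]
    using set_integral_has_pos_density_on[OF F _ mS] set_integral_indefinite[OF F R] by simp
qed

lemma density_pos: "\<theta> \<in> \<Theta> \<Longrightarrow> 0 < f \<theta>" "\<theta> \<in> \<Theta> \<Longrightarrow> v \<in> V \<Longrightarrow> 0 < g \<theta> v"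
  using F G by (auto simp: has_pos_density_on_def)

text \<open>Multiplying the virtual value by \<open>f \<theta> * g \<theta> v\<close> clears both of
  its denominators, leaving the surplus term and the rent term. Integrability of the section is a
  hypothesis because it is known only for almost every signal.\<close>

lemma
  assumes nonneg: "\<And>v. v \<in> V \<Longrightarrow> 0 \<le> q \<theta> v" and mono: "mono_on V (gain q \<theta>)"
    and \<theta>: "\<theta> \<in> \<Theta>" and int: "integrable lborel (\<lambda>v. gain q \<theta> v * decline \<theta> v)"
  shows set_integrable_virtual_value:
      "set_integrable lborel V (\<lambda>v. f \<theta> * g \<theta> v * (virtual_value F f g dG \<theta> v * gain q \<theta> v - c * q \<theta> v))"
      (is "set_integrable _ _ ?k")
    and virtual_surplus_eq:
      "virtual_surplus q \<theta> = (LINT v:V|lborel. f \<theta> * g \<theta> v * (virtual_value F f g dG \<theta> v * gain q \<theta> v - c * q \<theta> v))"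
proof -
  note S = set_integrable_surplus[of \<theta> q, OF \<theta> nonneg mono]
  define m where "m v = f \<theta> * (g \<theta> v * (v * gain q \<theta> v - c * q \<theta> v))" for v
  define d where "d v = (1 - cdf F \<theta>) * (gain q \<theta> v * decline \<theta> v)" for v
  have m: "set_integrable lborel V m"
    using S(2) set_integrable_has_pos_density_on_iff[OF G[OF \<theta>] _ S(1)] by (simp add: m_def[abs_def])
  have d: "set_integrable lborel V d"
    using int unfolding set_integrable_def d_def by (intro integrable_mult_indicator) auto
  have eq: "?k v = m v - d v" if "v \<in> V" for v
    using that \<theta> density_pos(1)[of \<theta>] density_pos(2)[of \<theta> v]
    by (simp add: m_def d_def virtual_value_def decline_def field_simps)
  show "set_integrable lborel V ?k"
    using set_integral_diff(1)[OF m d] eq by (subst set_integrable_cong[OF refl refl eq]) auto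
  have "(LINT v:V|lborel. ?k v) = (LINT v:V|lborel. m v - d v)"
    using eq by (intro set_lebesgue_integral_cong) auto
  also have "\<dots> = (LINT v:V|lborel. m v) - (LINT v:V|lborel. d v)"
    by (rule set_integral_diff(2)[OF m d])
  also have "(LINT v:V|lborel. m v) = f \<theta> * surplus q \<theta>"
    using set_integral_has_pos_density_on[OF G[OF \<theta>] _ S(1)] by (simp add: m_def[abs_def] surplus_def)
  also have "(LINT v:V|lborel. d v) = (LINT v|lborel. d v)"
    unfolding set_lebesgue_integral_def
    by (intro Bochner_Integration.integral_cong) (auto simp: d_def decline_def indicator_def)
  also have "\<dots> = rent (gain q) \<theta> * (1 - cdf F \<theta>)"
    by (simp add: d_def rent_def)
  finally show "virtual_surplus q \<theta> = (LINT v:V|lborel. ?k v)"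
    by (simp add: virtual_surplus_def)
qed

section \<open>The upper bound on profit for an arbitrary feasible mechanism\<close>

lemma set_borel_measurable_gain:
  assumes "set_borel_measurable borel (\<Theta> \<times> V) (\<lambda>(\<theta>, v). q \<theta> v)"
  shows "set_borel_measurable borel (\<Theta> \<times> V) (\<lambda>(\<theta>, v). gain q \<theta> v)"
proof -
  have [measurable]: "(\<lambda>z. q (fst z) (snd z)) \<in> borel_measurable (restrict_space borel (\<Theta> \<times> V))"
    using assms by (simp add: set_borel_measurable_restrict_space_iff borel_Times split_beta')
  show ?thesis
    by (subst set_borel_measurable_restrict_space_iff) (simp_all add: borel_Times split_beta')
qed

text \<open>The constraint that signal \<open>y\<close> does not imitate a lower \<open>x\<close>
  bounds increments of interim utility from below, and (IR) at the lowest signal fixes the starting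
  level.\<close>

lemma
  assumes feas: "feasible \<alpha> c \<Theta> V f g G q t"
  shows integrable_rent_feasible: "integrable (lborel \<Otimes>\<^sub>M lborel) (\<lambda>(x, v). gain q x v * decline x v)"
    and rent_le_interim: "\<theta> \<in> \<Theta> \<Longrightarrow> (LINT x:{\<theta>l..\<theta>}|lborel. rent (gain q) x) \<le> interim q t \<theta> \<theta>"
    and set_integrable_interim_feasible: "set_integrable F \<Theta> (\<lambda>\<theta>. interim q t \<theta> \<theta>)"
proof -
  note em = feasible_envelope_mechanism[OF feas]
  note E = envelope_mechanismD[OF em]
  have IC0: "interim q t \<theta> \<theta>' \<le> interim q t \<theta> \<theta>" if "\<theta> \<in> \<Theta>" "\<theta>' \<in> \<Theta>" for \<theta> \<theta>'
    using feas that by (auto simp: feasible_def IC0_def)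
  have IR: "0 \<le> interim q t \<theta> \<theta>" if "\<theta> \<in> \<Theta>" for \<theta>
    using feas that by (auto simp: feasible_def IR_def)
  have diff: "(LINT v:V|lborel. gain q x v * (cdf (G x) v - cdf (G y) v)) \<le> interim q t y y - interim q t x x"
    if "x \<in> \<Theta>" "y \<in> \<Theta>" for x y
    using IC0[OF that(2,1)] interim_diff[OF em that(2,1)] by simp
  note gm = set_borel_measurable_gain[OF E(2)]
  note [measurable] = borel_measurable_times_decline[OF gm]
  have nn: "(\<integral>\<^sup>+x. (\<integral>\<^sup>+v. ennreal (indicator {a..b} x * (gain q x v * decline x v)) \<partial>lborel) \<partial>lborel)
      \<le> ennreal (interim q t b b - interim q t a a)" if "a \<in> \<Theta>" "b \<in> \<Theta>" "a < b" for a b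
    by (rule nn_integral_rent_le[OF gm _ E(4) diff that]) auto
  have pair: "(\<integral>\<^sup>+z. ennreal (indicator {a..b} (fst z) * (gain q (fst z) (snd z) * decline (fst z) (snd z))) \<partial>(lborel \<Otimes>\<^sub>M lborel))
      \<le> ennreal (interim q t b b - interim q t a a)" if "a \<in> \<Theta>" "b \<in> \<Theta>" "a < b" for a b
    using nn[OF that] by (subst lborel.nn_integral_fst[symmetric]) (simp_all add: split_beta')
  \<comment> \<open>Nothing bounds \<open>q\<close> across signals; finiteness comes from the
    interim utilities at the two extreme signals being real numbers.\<close>
  show int: "integrable (lborel \<Otimes>\<^sub>M lborel) (\<lambda>(x, v). gain q x v * decline x v)"
  proof (rule integrableI_nonneg)
    have "(\<integral>\<^sup>+z. ennreal (case z of (x, v) \<Rightarrow> gain q x v * decline x v) \<partial>(lborel \<Otimes>\<^sub>M lborel)) =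
      (\<integral>\<^sup>+z. ennreal (indicator \<Theta> (fst z) * (gain q (fst z) (snd z) * decline (fst z) (snd z))) \<partial>(lborel \<Otimes>\<^sub>M lborel))"
      by (intro nn_integral_cong) (auto simp: decline_def indicator_def split: prod.splits)
    also have "\<dots> < \<infinity>"
      using pair[of \<theta>l \<theta>h] signals by (auto simp: less_top[symmetric] top_unique)
    finally show "(\<integral>\<^sup>+z. ennreal (case z of (x, v) \<Rightarrow> gain q x v * decline x v) \<partial>(lborel \<Otimes>\<^sub>M lborel)) < \<infinity>" .
  qed (auto simp: decline_nonneg)
  show "(LINT x:{\<theta>l..\<theta>}|lborel. rent (gain q) x) \<le> interim q t \<theta> \<theta>" if \<theta>: "\<theta> \<in> \<Theta>"
  proof (cases "\<theta>l < \<theta>")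
    case True
    have "ennreal (LINT x:{\<theta>l..\<theta>}|lborel. rent (gain q) x) \<le> ennreal (interim q t \<theta> \<theta> - interim q t \<theta>l \<theta>l)"
      using pair[of \<theta>l \<theta>] True \<theta> set_integral_rent[OF int, of "{\<theta>l..\<theta>}"]
      by (subst (asm) nn_integral_eq_integral) (auto simp: decline_nonneg)
    \<comment> \<open>Needed to leave \<open>ennreal\<close>, which maps negative numbers to
      0.\<close>
    moreover have "0 \<le> interim q t \<theta> \<theta> - interim q t \<theta>l \<theta>l"
    proof -
      have "0 \<le> (LINT v:V|lborel. gain q \<theta>l v * (cdf (G \<theta>l) v - cdf (G \<theta>) v))"
        unfolding set_lebesgue_integral_def using \<theta> signals cdf_G_antimono[of \<theta> \<theta>l]
        by (intro integral_nonneg_AE AE_I2) (auto simp: indicator_def)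
      then show ?thesis using diff[of \<theta>l \<theta>] \<theta> signals by auto
    qed
    ultimately have "(LINT x:{\<theta>l..\<theta>}|lborel. rent (gain q) x) \<le> interim q t \<theta> \<theta> - interim q t \<theta>l \<theta>l"
      by (simp add: ennreal_le_iff)
    then show ?thesis using IR[of \<theta>l] signals by simp
  next
    case False
    with \<theta> have "\<theta> = \<theta>l" by simp
    moreover have "(LINT x:{\<theta>l..\<theta>l}|lborel. rent (gain q) x) = 0"
      using set_borel_integral_eq_integral(2)[OF set_integrable_rent[OF int]] by simp
    ultimately show ?thesis using IR[OF \<theta>] by simp
  qed
  \<comment> \<open>Monotonicity yields both measurability and boundedness, hence integrability
    against the probability measure \<open>F\<close>.\<close>
  have mono: "mono_on \<Theta> (\<lambda>\<theta>. interim q t \<theta> \<theta>)"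
  proof (rule mono_onI)
    fix x y assume xy: "x \<in> \<Theta>" "y \<in> \<Theta>" "x \<le> y"
    have "0 \<le> (LINT v:V|lborel. gain q x v * (cdf (G x) v - cdf (G y) v))"
      unfolding set_lebesgue_integral_def using xy cdf_G_antimono[of y x]
      by (intro integral_nonneg_AE AE_I2) (auto simp: indicator_def)
    then show "interim q t x x \<le> interim q t y y" using diff[OF xy(1,2)] by simp
  qed
  interpret F: prob_space F by (rule prob_F)
  show "set_integrable F \<Theta> (\<lambda>\<theta>. interim q t \<theta> \<theta>)"
  proof (rule set_integrable_bounded[OF _ _ _ abs_le_mono_on[OF mono]])
    show "set_borel_measurable F \<Theta> (\<lambda>\<theta>. interim q t \<theta> \<theta>)"
      using set_borel_measurable_mono_on[OF mono] sets_F
      unfolding set_borel_measurable_def by (simp cong: measurable_cong_sets)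
    show "emeasure F \<Theta> < \<infinity>" using F.emeasure_finite[of \<Theta>] by (simp add: less_top[symmetric])
  qed (use sets_F in auto)
qed

text \<open>The only loss is interim utility in excess of the rent; every other step in this bound
  is an identity.\<close>

lemma profit_le_virtual_surplus:
  assumes feas: "feasible \<alpha> c \<Theta> V f g G q t"
  shows "set_integrable lborel \<Theta> (virtual_surplus q)"
    and "expected_profit c \<Theta> V f g q t \<le> (LINT \<theta>:\<Theta>|lborel. virtual_surplus q \<theta>)"
proof -
  note em = feasible_envelope_mechanism[OF feas]
  note R = integrable_rent_feasible[OF feas] rent_le_interim[OF feas] set_integrable_interim_feasible[OF feas]
  have "set_integrable (joint_dist \<Theta> V f g) (\<Theta> \<times> V) (\<lambda>(\<theta>, v). t \<theta> v - q \<theta> v * c)"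
    using feas by (simp add: feasible_def)
  note P = profit_eq[OF em this R(3)]
  show "set_integrable lborel \<Theta> (virtual_surplus q)"
    by (rule set_integrable_virtual_surplus[OF envelope_mechanismD(2)[OF em] P(1) R(1)])
  have "(LINT \<theta>:\<Theta>|F. LINT x:{\<theta>l..\<theta>}|lborel. rent (gain q) x) \<le> (LINT \<theta>:\<Theta>|F. interim q t \<theta> \<theta>)"
    using R(2) by (intro set_integral_mono set_integrable_indefinite[OF F] set_integrable_rent[OF R(1)] R(3)) auto
  then show "expected_profit c \<Theta> V f g q t \<le> (LINT \<theta>:\<Theta>|lborel. virtual_surplus q \<theta>)"
    using P(2) set_integral_virtual_surplus[OF envelope_mechanismD(2)[OF em] P(1) R(1)] by simp
qed

text \<open>The pointwise comparison can be integrated over \<open>v\<close> only at signals where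
  both sections of the rent are integrable, hence the almost-everywhere argument. The transfers
  merely witness the envelope property.\<close>

lemma set_integral_virtual_surplus_mono:
  assumes q: "envelope_mechanism q t" "set_integrable lborel \<Theta> (virtual_surplus q)"
      "integrable (lborel \<Otimes>\<^sub>M lborel) (\<lambda>(x, v). gain q x v * decline x v)"
    and q': "envelope_mechanism q' t'" "set_integrable lborel \<Theta> (virtual_surplus q')"
      "integrable (lborel \<Otimes>\<^sub>M lborel) (\<lambda>(x, v). gain q' x v * decline x v)"
    and le: "\<And>\<theta> v. \<theta> \<in> \<Theta> \<Longrightarrow> v \<in> V \<Longrightarrow>
      virtual_value F f g dG \<theta> v * gain q \<theta> v - c * q \<theta> v \<le> virtual_value F f g dG \<theta> v * gain q' \<theta> v - c * q' \<theta> v"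
  shows "(LINT \<theta>:\<Theta>|lborel. virtual_surplus q \<theta>) \<le> (LINT \<theta>:\<Theta>|lborel. virtual_surplus q' \<theta>)"
proof (rule set_integral_mono_AE[OF q(2) q'(2)])
  note E = envelope_mechanismD[OF q(1)] and E' = envelope_mechanismD[OF q'(1)]
  show "AE \<theta>\<in>\<Theta> in lborel. virtual_surplus q \<theta> \<le> virtual_surplus q' \<theta>"
    using AE_integrable_rent[OF q(3)] AE_integrable_rent[OF q'(3)]
  proof eventually_elim
    case (elim \<theta>)
    show ?case
    proof
      assume \<theta>: "\<theta> \<in> \<Theta>"
      have nonneg: "\<And>v. v \<in> V \<Longrightarrow> 0 \<le> q \<theta> v" "\<And>v. v \<in> V \<Longrightarrow> 0 \<le> q' \<theta> v"
        using E(1) E'(1) \<theta> by auto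
      note v = virtual_surplus_eq[of q \<theta>, OF _ E(4)[OF \<theta>] \<theta> elim(1)]
        virtual_surplus_eq[of q' \<theta>, OF _ E'(4)[OF \<theta>] \<theta> elim(2)]
      note w = set_integrable_virtual_value[of q \<theta>, OF _ E(4)[OF \<theta>] \<theta> elim(1)]
        set_integrable_virtual_value[of q' \<theta>, OF _ E'(4)[OF \<theta>] \<theta> elim(2)]
      show "virtual_surplus q \<theta> \<le> virtual_surplus q' \<theta>"
      proof (subst v(1), rule nonneg(1), assumption, subst v(2), rule nonneg(2), assumption, rule set_integral_mono)
        show "set_integrable lborel V (\<lambda>v. f \<theta> * g \<theta> v * (virtual_value F f g dG \<theta> v * gain q \<theta> v - c * q \<theta> v))"
          by (rule w(1)) (rule nonneg(1))
        show "set_integrable lborel V (\<lambda>v. f \<theta> * g \<theta> v * (virtual_value F f g dG \<theta> v * gain q' \<theta> v - c * q' \<theta> v))"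
          by (rule w(2)) (rule nonneg(2))
      next
        fix v assume v: "v \<in> V"
        show "f \<theta> * g \<theta> v * (virtual_value F f g dG \<theta> v * gain q \<theta> v - c * q \<theta> v) \<le>
          f \<theta> * g \<theta> v * (virtual_value F f g dG \<theta> v * gain q' \<theta> v - c * q' \<theta> v)"
          using le[OF \<theta> v] density_pos(1)[OF \<theta>] density_pos(2)[OF \<theta> v] by (intro mult_left_mono) auto
      qed
    qed
  qed
qed

subsection \<open>The mechanism with quantities \<open>q\<^sup>*\<close>\<close>

lemma integrable_bounded_times_decline:
  assumes p: "set_borel_measurable borel (\<Theta> \<times> V) (\<lambda>(x, v). p x v)"
    and bd: "\<And>x v. x \<in> \<Theta> \<Longrightarrow> v \<in> V \<Longrightarrow> \<bar>p x v\<bar> \<le> B"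
  shows "integrable (lborel \<Otimes>\<^sub>M lborel) (\<lambda>(x, v). p x v * decline x v)"
proof (rule Bochner_Integration.integrable_bound)
  note [measurable] = borel_measurable_times_decline[OF p]
  show "integrable (lborel \<Otimes>\<^sub>M lborel) (\<lambda>z. B * (case z of (x, v) \<Rightarrow> decline x v))"
    using integrable_decline by simp
  show "(\<lambda>(x, v). p x v * decline x v) \<in> borel_measurable (lborel \<Otimes>\<^sub>M lborel)" by measurable
  have "\<bar>p x v * decline x v\<bar> \<le> \<bar>B * decline x v\<bar>" for x v
  proof (cases "x \<in> \<Theta> \<and> v \<in> V")
    case True
    then have "\<bar>p x v\<bar> \<le> \<bar>B\<bar>" using bd[of x v] by auto
    then show ?thesis by (simp add: abs_mult mult_right_mono)
  next
    case False
    then have "decline x v = 0" by (auto simp: decline_def indicator_def)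
    then show ?thesis by simp
  qed
  then show "AE z in lborel \<Otimes>\<^sub>M lborel. norm (case z of (x, v) \<Rightarrow> p x v * decline x v) \<le> norm (B * (case z of (x, v) \<Rightarrow> decline x v))"
    by (intro AE_I2) (auto split: prod.split)
qed

lemma integral_decline:
  assumes "a \<in> \<Theta>" "b \<in> \<Theta>" "a \<le> b" "v \<in> V"
  shows "(LINT x|lborel. indicator {a..b} x * decline x v) = cdf (G a) v - cdf (G b) v"
proof -
  note [measurable] = borel_measurable_decline
  have "(\<lambda>x. case (x, v) of (x, v) \<Rightarrow> decline x v) \<in> borel_measurable borel" by measurable
  then have [measurable]: "(\<lambda>x. decline x v) \<in> borel_measurable borel" by simp
  show ?thesis
    using nn_integral_decline[OF assms] cdf_G_antimono[OF assms(2,1,3,4)]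
    by (subst integral_eq_nn_integral) (auto simp: decline_nonneg)
qed

text \<open>For a schedule frozen at one report, the integral over signals acts on
  \<open>decline\<close> alone and telescopes. The result is the gain from misreporting in
  \<open>interim_diff\<close>, so incentive constraints become comparisons of rents.\<close>

lemma
  assumes r: "mono_on V r"
  shows integrable_const_times_decline: "integrable (lborel \<Otimes>\<^sub>M lborel) (\<lambda>(x, v). r v * decline x v)"
    and set_integral_rent_const: "a \<in> \<Theta> \<Longrightarrow> b \<in> \<Theta> \<Longrightarrow> a \<le> b \<Longrightarrow>
      (LINT x:{a..b}|lborel. rent (\<lambda>_. r) x) = (LINT v:V|lborel. r v * (cdf (G a) v - cdf (G b) v))"
proof -
  have "set_borel_measurable borel (\<Theta> \<times> V) (\<lambda>(x, v). r v)"
  proof -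
    have [measurable]: "(\<lambda>v. indicator V v * r v) \<in> borel_measurable borel"
      using set_borel_measurable_mono_on[OF r] by (simp add: set_borel_measurable_def)
    have "(\<lambda>z. indicator \<Theta> (fst z) * (indicator V (snd z) * r (snd z))) \<in> borel_measurable (borel \<Otimes>\<^sub>M borel)"
      by measurable
    then show ?thesis
      by (simp add: set_borel_measurable_def borel_prod split_beta' indicator_times mult.assoc)
  qed
  then show int: "integrable (lborel \<Otimes>\<^sub>M lborel) (\<lambda>(x, v). r v * decline x v)"
    using abs_le_mono_on[OF r] by (rule integrable_bounded_times_decline)
  assume ab: "a \<in> \<Theta>" "b \<in> \<Theta>" "a \<le> b"
  have "integrable (lborel \<Otimes>\<^sub>M lborel) (\<lambda>(x, v). indicator {a..b} x * (r v * decline x v))"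
    using set_integral_rent(2)[OF int, of "{a..b}"] by (simp add: split_beta')
  note sw = lborel_pair.integral_snd[OF this]
  have "(LINT x:{a..b}|lborel. rent (\<lambda>_. r) x) = (LINT v|lborel. LINT x|lborel. indicator {a..b} x * (r v * decline x v))"
    unfolding sw using set_integral_rent(1)[OF int, of "{a..b}"] by (simp add: split_beta')
  also have "\<dots> = (LINT v:V|lborel. r v * (cdf (G a) v - cdf (G b) v))"
    unfolding set_lebesgue_integral_def
  proof (intro Bochner_Integration.integral_cong refl)
    fix v
    have "(LINT x|lborel. indicator {a..b} x * (r v * decline x v)) = r v * (LINT x|lborel. indicator {a..b} x * decline x v)"
      by (subst integral_mult_right_zero[symmetric]) (simp add: algebra_simps)
    also have "\<dots> = indicator V v *\<^sub>R (r v * (cdf (G a) v - cdf (G b) v))"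
    proof (cases "v \<in> V")
      case False
      then have "decline x v = 0" for x by (auto simp: decline_def indicator_def)
      with False show ?thesis by simp
    qed (simp add: integral_decline[OF ab])
    finally show "(LINT x|lborel. indicator {a..b} x * (r v * decline x v)) = indicator V v *\<^sub>R (r v * (cdf (G a) v - cdf (G b) v))" .
  qed
  finally show "(LINT x:{a..b}|lborel. rent (\<lambda>_. r) x) = (LINT v:V|lborel. r v * (cdf (G a) v - cdf (G b) v))" .
qed

lemma set_borel_measurable_virtual_value:
  "set_borel_measurable borel (\<Theta> \<times> V) (\<lambda>(\<theta>, v). virtual_value F f g dG \<theta> v)"
proof -
  note [measurable] = borel_measurable_decline borel_measurable_cdf[OF F, simplified]
  have [measurable]: "(\<lambda>\<theta>. indicator \<Theta> \<theta> * f \<theta>) \<in> borel_measurable borel"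
    "(\<lambda>z. indicator (\<Theta> \<times> V) z *\<^sub>R (case z of (\<theta>, v) \<Rightarrow> g \<theta> v)) \<in> borel_measurable (borel \<Otimes>\<^sub>M borel)"
    using has_pos_density_onD(4)[OF F] g_meas by (simp_all add: set_borel_measurable_def borel_prod)
  \<comment> \<open>The inner indicators make each factor measurable on the whole plane. Off the
    rectangle they may put 0 into a denominator, where division gives 0, and the outer indicator
    masks the result.\<close>
  have "(\<lambda>z. indicator (\<Theta> \<times> V) z * (snd z + (1 - cdf F (fst z)) / (indicator \<Theta> (fst z) * f (fst z)) *
      (- (case z of (x, v) \<Rightarrow> decline x v) / (indicator (\<Theta> \<times> V) z *\<^sub>R (case z of (\<theta>, v) \<Rightarrow> g \<theta> v)))))
    \<in> borel_measurable (borel \<Otimes>\<^sub>M borel)" (is "?h \<in> _")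
    by measurable
  also have "?h = (\<lambda>z. indicator (\<Theta> \<times> V) z *\<^sub>R (case z of (\<theta>, v) \<Rightarrow> virtual_value F f g dG \<theta> v))"
  proof
    fix z show "?h z = indicator (\<Theta> \<times> V) z *\<^sub>R (case z of (\<theta>, v) \<Rightarrow> virtual_value F f g dG \<theta> v)"
    proof (cases "z \<in> \<Theta> \<times> V")
      case True
      then obtain x v where "z = (x, v)" "x \<in> \<Theta>" "v \<in> V" by auto
      then show ?thesis by (simp add: virtual_value_def decline_def)
    qed simp
  qed
  finally show ?thesis by (simp add: set_borel_measurable_def borel_prod)
qed

end

text \<open>Regularity makes \<open>q_star\<close> monotone in both arguments. In the value this
  serves (IC1), in the signal (IC0), and together they bound it by its value at
  \<open>\<theta>h\<close> and \<open>vh\<close>, which settles integrability.\<close>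

locale regular_screening = screening +
  assumes regular: "\<And>v. v \<in> V \<Longrightarrow> mono_on \<Theta> (\<lambda>\<theta>. virtual_value F f g dG \<theta> v)"
      "\<And>\<theta>. \<theta> \<in> \<Theta> \<Longrightarrow> mono_on V (\<lambda>v. virtual_value F f g dG \<theta> v)"
begin

abbreviation qs :: "real \<Rightarrow> real \<Rightarrow> real" where
  "qs \<equiv> q_star \<alpha> c (virtual_value F f g dG)"

lemma qs_nonneg: "0 \<le> qs \<theta> v"
  by (simp add: q_star_def)

lemma qs_mono:
  assumes "\<theta> \<in> \<Theta>" "\<theta>' \<in> \<Theta>" "\<theta> \<le> \<theta>'" "v \<in> V" "v' \<in> V" "v \<le> v'"
  shows "qs \<theta> v \<le> qs \<theta>' v'"
proof (rule q_star_mono[OF alpha cost])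
  have "virtual_value F f g dG \<theta> v \<le> virtual_value F f g dG \<theta>' v"
    using assms by (intro mono_onD[OF regular(1)])
  also have "\<dots> \<le> virtual_value F f g dG \<theta>' v'"
    using assms by (intro mono_onD[OF regular(2)])
  finally show "virtual_value F f g dG \<theta> v \<le> virtual_value F f g dG \<theta>' v'" .
qed

lemma gain_qs_mono:
  assumes "\<theta> \<in> \<Theta>" "\<theta>' \<in> \<Theta>" "\<theta> \<le> \<theta>'" "v \<in> V" "v' \<in> V" "v \<le> v'"
  shows "gain qs \<theta> v \<le> gain qs \<theta>' v'"
  using qs_mono[OF assms] qs_nonneg alpha by (intro powr_mono2) auto

lemma mono_on_gain_qs: "\<theta> \<in> \<Theta> \<Longrightarrow> mono_on V (gain qs \<theta>)"
  by (intro mono_onI gain_qs_mono) auto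

lemma gain_qs_le: "\<theta> \<in> \<Theta> \<Longrightarrow> v \<in> V \<Longrightarrow> gain qs \<theta> v \<le> gain qs \<theta>h vh"
  using signals vals by (intro gain_qs_mono) auto

lemma set_borel_measurable_qs: "set_borel_measurable borel (\<Theta> \<times> V) (\<lambda>(\<theta>, v). qs \<theta> v)"
proof -
  have [measurable]: "(\<lambda>z. virtual_value F f g dG (fst z) (snd z)) \<in> borel_measurable (restrict_space borel (\<Theta> \<times> V))"
    using set_borel_measurable_virtual_value
    by (simp add: set_borel_measurable_restrict_space_iff borel_Times split_beta')
  show ?thesis
    by (subst set_borel_measurable_restrict_space_iff)
       (simp_all add: q_star_def borel_Times split_beta', measurable)
qed

lemma integrable_rent_qs: "integrable (lborel \<Otimes>\<^sub>M lborel) (\<lambda>(x, v). gain qs x v * decline x v)"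
  using gain_qs_le
  by (intro integrable_bounded_times_decline[OF set_borel_measurable_gain[OF set_borel_measurable_qs]]) auto

section \<open>The prescribed interim utility\<close>

text \<open>The right-hand side of the second transfer equation, its minus sign absorbed into
  \<open>decline\<close>.\<close>

definition rent_upto :: "real \<Rightarrow> real" where
  "rent_upto \<theta> = (LINT x:{\<theta>l..\<theta>}|lborel. rent (gain qs) x)"

lemma rent_upto_eq:
  assumes "\<theta> \<in> \<Theta>"
  shows "rent_upto \<theta> = - (LINT x:{\<theta>l..\<theta>}|lborel. LINT v:V|lborel. gain qs x v * dG x v)"
proof -
  have "rent (gain qs) x = - (LINT v:V|lborel. gain qs x v * dG x v)" if "x \<in> \<Theta>" for x
  proof -
    have "rent (gain qs) x = (LINT v|lborel. - (indicator V v *\<^sub>R (gain qs x v * dG x v)))"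
      unfolding rent_def using that
      by (intro Bochner_Integration.integral_cong) (auto simp: decline_def indicator_def)
    then show ?thesis by (simp add: set_lebesgue_integral_def)
  qed
  then have "rent_upto \<theta> = (LINT x:{\<theta>l..\<theta>}|lborel. - (LINT v:V|lborel. gain qs x v * dG x v))"
    unfolding rent_upto_def using assms by (intro set_lebesgue_integral_cong) auto
  then show ?thesis by (simp add: set_lebesgue_integral_def)
qed

lemma rent_upto_diff:
  assumes "a \<in> \<Theta>" "b \<in> \<Theta>" "a \<le> b"
  shows "rent_upto b - rent_upto a = (LINT x:{a..b}|lborel. rent (gain qs) x)"
proof -
  have i: "set_integrable lborel {x..y} (rent (gain qs))" for x y
    by (rule set_integrable_rent[OF integrable_rent_qs]) simp
  note hk = set_borel_integral_eq_integral[OF i]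
  show ?thesis
    using Henstock_Kurzweil_Integration.integral_combine[of \<theta>l a b "rent (gain qs)"] hk assms
    by (simp add: rent_upto_def)
qed

text \<open>For signals between \<open>a\<close> and \<open>b\<close>, the gain lies between its
  values at \<open>a\<close> and at \<open>b\<close>, and \<open>decline\<close> is nonnegative; so
  the rent lies between those of the two frozen schedules. The lower bound deters \<open>b\<close>
  from reporting \<open>a\<close>, the upper one \<open>a\<close> from reporting
  \<open>b\<close>.\<close>

lemma rent_upto_diff_bounds:
  assumes ab: "a \<in> \<Theta>" "b \<in> \<Theta>" "a \<le> b"
  shows "(LINT v:V|lborel. gain qs a v * (cdf (G a) v - cdf (G b) v)) \<le> rent_upto b - rent_upto a"
    and "rent_upto b - rent_upto a \<le> (LINT v:V|lborel. gain qs b v * (cdf (G a) v - cdf (G b) v))"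
proof -
  note ia = integrable_const_times_decline[OF mono_on_gain_qs[OF ab(1)]]
  note ib = integrable_const_times_decline[OF mono_on_gain_qs[OF ab(2)]]
  note iq = integrable_rent_qs
  have sub: "{a..b} \<subseteq> \<Theta>" using ab by auto
  have le: "p x v * decline x v \<le> p' x v * decline x v"
    if "\<And>v. v \<in> V \<Longrightarrow> p x v \<le> p' x v" for p p' :: "real \<Rightarrow> real \<Rightarrow> real" and x v
  proof (cases "v \<in> V")
    case True
    then show ?thesis using that decline_nonneg by (intro mult_right_mono) auto
  next
    case False
    then have "decline x v = 0" by (auto simp: decline_def indicator_def)
    then show ?thesis by simp
  qed
  have "(LINT x:{a..b}|lborel. rent (\<lambda>_. gain qs a) x) \<le> (LINT x:{a..b}|lborel. rent (gain qs) x)"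
  proof (rule set_integral_mono_AE[OF set_integrable_rent[OF ia] set_integrable_rent[OF iq]])
    show "AE x\<in>{a..b} in lborel. rent (\<lambda>_. gain qs a) x \<le> rent (gain qs) x"
      using AE_integrable_rent[OF ia] AE_integrable_rent[OF iq]
    proof eventually_elim
      case (elim x)
      show ?case
        unfolding rent_def using elim sub ab
        by (intro impI integral_mono le gain_qs_mono) auto
    qed
  qed auto
  then show "(LINT v:V|lborel. gain qs a v * (cdf (G a) v - cdf (G b) v)) \<le> rent_upto b - rent_upto a"
    unfolding rent_upto_diff[OF ab] set_integral_rent_const[OF mono_on_gain_qs[OF ab(1)] ab] .
  have "(LINT x:{a..b}|lborel. rent (gain qs) x) \<le> (LINT x:{a..b}|lborel. rent (\<lambda>_. gain qs b) x)"
  proof (rule set_integral_mono_AE[OF set_integrable_rent[OF iq] set_integrable_rent[OF ib]])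
    show "AE x\<in>{a..b} in lborel. rent (gain qs) x \<le> rent (\<lambda>_. gain qs b) x"
      using AE_integrable_rent[OF ib] AE_integrable_rent[OF iq]
    proof eventually_elim
      case (elim x)
      show ?case
        unfolding rent_def using elim sub ab
        by (intro impI integral_mono le gain_qs_mono) auto
    qed
  qed auto
  then show "rent_upto b - rent_upto a \<le> (LINT v:V|lborel. gain qs b v * (cdf (G a) v - cdf (G b) v))"
    unfolding rent_upto_diff[OF ab] set_integral_rent_const[OF mono_on_gain_qs[OF ab(2)] ab] .
qed

lemma rent_upto_mono: "mono_on \<Theta> rent_upto"
proof (rule mono_onI)
  fix a b assume ab: "a \<in> \<Theta>" "b \<in> \<Theta>" "a \<le> b"
  have "0 \<le> (LINT v:V|lborel. gain qs a v * (cdf (G a) v - cdf (G b) v))"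
    unfolding set_lebesgue_integral_def using ab cdf_G_antimono[of b a]
    by (intro integral_nonneg_AE AE_I2) (auto simp: indicator_def)
  with rent_upto_diff_bounds(1)[OF ab] show "rent_upto a \<le> rent_upto b" by simp
qed

lemma rent_upto_nonneg: "\<theta> \<in> \<Theta> \<Longrightarrow> 0 \<le> rent_upto \<theta>"
  unfolding rent_upto_def set_lebesgue_integral_def rent_def
  by (intro integral_nonneg_AE AE_I2) (auto simp: decline_nonneg intro!: mult_nonneg_nonneg integral_nonneg_AE)

text \<open>The ex post utility in excess of that of value \<open>vl\<close>, as dictated by the
  first transfer equation.\<close>

definition slack :: "real \<Rightarrow> real \<Rightarrow> real" where
  "slack \<theta> v = (LINT x:{vl..v}|lborel. gain qs \<theta> x)"

definition slack_bound :: real where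
  "slack_bound = gain qs \<theta>h vh * (vh - vl)"

lemma slack_bounds:
  assumes "\<theta> \<in> \<Theta>" "v \<in> V"
  shows "0 \<le> slack \<theta> v" "slack \<theta> v \<le> slack_bound"
proof -
  show "0 \<le> slack \<theta> v"
    unfolding slack_def set_lebesgue_integral_def by (intro integral_nonneg_AE AE_I2) auto
  have i: "set_integrable lborel {vl..v} (gain qs \<theta>)"
    using assms by (intro set_integrable_mono_on mono_on_subset[OF mono_on_gain_qs]) auto
  have "slack \<theta> v \<le> (LINT x:{vl..v}|lborel. gain qs \<theta>h vh)"
    unfolding slack_def using assms by (intro set_integral_mono i) (auto simp: set_integrable_def intro!: gain_qs_le)
  also have "\<dots> = gain qs \<theta>h vh * (v - vl)"
    using assms by (simp add: set_lebesgue_integral_def)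
  also have "\<dots> \<le> slack_bound"
    unfolding slack_bound_def using assms by (intro mult_left_mono) auto
  finally show "slack \<theta> v \<le> slack_bound" .
qed

lemma set_borel_measurable_slack: "set_borel_measurable borel (\<Theta> \<times> V) (\<lambda>(\<theta>, v). slack \<theta> v)"
proof -
  define gb where "gb z = indicator (\<Theta> \<times> V) z *\<^sub>R (case z of (\<theta>, v) \<Rightarrow> gain qs \<theta> v)" for z
  have [measurable]: "gb \<in> borel_measurable (borel \<Otimes>\<^sub>M borel)"
    using set_borel_measurable_gain[OF set_borel_measurable_qs]
    by (simp add: set_borel_measurable_def borel_prod gb_def[abs_def])
  have "(\<lambda>z. indicator (\<Theta> \<times> V) z * (LINT x|lborel. indicator {(v, x). x \<le> v} (snd z, x) * gb (fst z, x)))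
    \<in> borel_measurable (borel \<Otimes>\<^sub>M borel)" (is "?h \<in> _")
    by measurable
  also have "?h = (\<lambda>z. indicator (\<Theta> \<times> V) z *\<^sub>R (case z of (\<theta>, v) \<Rightarrow> slack \<theta> v))"
  proof
    fix z show "?h z = indicator (\<Theta> \<times> V) z *\<^sub>R (case z of (\<theta>, v) \<Rightarrow> slack \<theta> v)"
    proof (cases "z \<in> \<Theta> \<times> V")
      case True
      then obtain \<theta> v where z: "z = (\<theta>, v)" "\<theta> \<in> \<Theta>" "v \<in> V" by auto
      have "(LINT x|lborel. indicator {(v, x). x \<le> v} (snd z, x) * gb (fst z, x)) = slack \<theta> v"
        unfolding slack_def set_lebesgue_integral_def using z
        by (intro Bochner_Integration.integral_cong) (auto simp: gb_def indicator_def)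
      then show ?thesis using z by simp
    qed simp
  qed
  finally show ?thesis by (simp add: set_borel_measurable_def borel_prod)
qed

definition expected_slack :: "real \<Rightarrow> real" where
  "expected_slack \<theta> = (LINT v:V|G \<theta>. slack \<theta> v)"

lemma expected_slack_eq:
  assumes "\<theta> \<in> \<Theta>"
  shows "expected_slack \<theta> = (LINT x:V|lborel. gain qs \<theta> x * (1 - cdf (G \<theta>) x))"
  unfolding expected_slack_def slack_def
  by (rule set_integral_indefinite[OF G[OF assms] set_integrable_mono_on[OF mono_on_gain_qs[OF assms]]])

lemma expected_slack_bounds:
  assumes \<theta>: "\<theta> \<in> \<Theta>"
  shows "0 \<le> expected_slack \<theta>" "expected_slack \<theta> \<le> slack_bound"
proof -
  show "0 \<le> expected_slack \<theta>"
    unfolding expected_slack_def set_lebesgue_integral_def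
    using slack_bounds(1)[OF \<theta>] by (intro integral_nonneg_AE AE_I2) (auto simp: indicator_def)
  interpret prob_space "G \<theta>" using prob_G[OF \<theta>] .
  note s[simp] = has_pos_density_onD(2,3)[OF G[OF \<theta>], simplified]
  have "prob V = 1"
    using AE_has_pos_density_on[OF G[OF \<theta>]] by (subst prob_eq_1) auto
  then have "(LINT v:V|G \<theta>. slack_bound) = slack_bound" by (simp add: set_lebesgue_integral_def)
  moreover have "set_integrable (G \<theta>) V (slack \<theta>)"
    unfolding slack_def[abs_def]
    by (rule set_integrable_indefinite[OF G[OF \<theta>] set_integrable_mono_on[OF mono_on_gain_qs[OF \<theta>]]])
  moreover have "set_integrable (G \<theta>) V (\<lambda>_. slack_bound)"
    unfolding set_integrable_def by (rule integrable_mult_indicator) auto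
  ultimately show "expected_slack \<theta> \<le> slack_bound"
    using set_integral_mono[of "G \<theta>" V "slack \<theta>" "\<lambda>_. slack_bound"] slack_bounds(2)[OF \<theta>]
    by (simp add: expected_slack_def)
qed

lemma set_borel_measurable_expected_slack: "set_borel_measurable borel \<Theta> expected_slack"
  unfolding expected_slack_def[abs_def] by (rule set_borel_measurable_interim[OF set_borel_measurable_slack])

text \<open>Taking expectations in the first equation and comparing with the second forces the
  utility at \<open>vl\<close> to be \<open>rent_upto \<theta> - expected_slack \<theta>\<close>.
  The explicit form yields existence, measurability and bounds of the transfers, which are pinned
  down on the rectangle only.\<close>

lemma transfer_equations_iff:
  "transfer_equations \<alpha> \<theta>l \<theta>h vl vh G dG qs t \<longleftrightarrow>
    (\<forall>\<theta>\<in>\<Theta>. \<forall>v\<in>V. t \<theta> v = v * gain qs \<theta> v - (rent_upto \<theta> - expected_slack \<theta> + slack \<theta> v))"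
  (is "_ \<longleftrightarrow> ?explicit")
proof -
  have "transfer_equations \<alpha> \<theta>l \<theta>h vl vh G dG qs t \<longleftrightarrow>
    (\<forall>\<theta>\<in>\<Theta>. (\<forall>v\<in>V. util qs t \<theta> v = util qs t \<theta> vl + slack \<theta> v) \<and> interim qs t \<theta> \<theta> = rent_upto \<theta>)"
    by (auto simp: transfer_equations_def Let_def interim_util_def rent_upto_eq slack_def)
  also have "\<dots> \<longleftrightarrow> (\<forall>\<theta>\<in>\<Theta>. \<forall>v\<in>V. util qs t \<theta> v = rent_upto \<theta> - expected_slack \<theta> + slack \<theta> v)"
  proof (intro ball_cong refl)
    fix \<theta> assume \<theta>: "\<theta> \<in> \<Theta>"
    have interim: "interim qs t \<theta> \<theta> = util qs t \<theta> vl + expected_slack \<theta>"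
      if "\<And>v. v \<in> V \<Longrightarrow> util qs t \<theta> v = util qs t \<theta> vl + slack \<theta> v"
      unfolding interim_util_def expected_slack_eq[OF \<theta>]
      by (rule set_integral_envelope[OF mono_on_gain_qs[OF \<theta>] \<theta>]) (rule that[unfolded slack_def])
    \<comment> \<open>For the converse: evaluating the explicit form at \<open>vl\<close> recovers
      the constant in the first equation.\<close>
    have "slack \<theta> vl = 0"
      unfolding slack_def using set_borel_integral_eq_integral(2)[of "{vl..vl}" "gain qs \<theta>"]
      by (simp add: set_integrable_mono_on mono_on_def)
    moreover have "vl \<in> V" using vals by simp
    ultimately show "((\<forall>v\<in>V. util qs t \<theta> v = util qs t \<theta> vl + slack \<theta> v) \<and> interim qs t \<theta> \<theta> = rent_upto \<theta>) \<longleftrightarrow>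
      (\<forall>v\<in>V. util qs t \<theta> v = rent_upto \<theta> - expected_slack \<theta> + slack \<theta> v)"
      using interim by (smt (verit))
  qed
  also have "\<dots> \<longleftrightarrow> ?explicit"
    unfolding buyer_util_def by (intro ball_cong refl) linarith
  finally show ?thesis .
qed

section \<open>Feasibility and optimality for any solution of the transfer equations\<close>

context
  fixes t
  assumes t: "transfer_equations \<alpha> \<theta>l \<theta>h vl vh G dG qs t"
begin

lemma interim_qs: "\<theta> \<in> \<Theta> \<Longrightarrow> interim qs t \<theta> \<theta> = rent_upto \<theta>"
  using t by (auto simp: transfer_equations_def Let_def interim_util_def rent_upto_eq)

lemma transfer_eq:
  "\<theta> \<in> \<Theta> \<Longrightarrow> v \<in> V \<Longrightarrow> t \<theta> v = v * gain qs \<theta> v - (rent_upto \<theta> - expected_slack \<theta> + slack \<theta> v)"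
  using t unfolding transfer_equations_iff by blast

lemma set_borel_measurable_transfer: "set_borel_measurable borel (\<Theta> \<times> V) (\<lambda>(\<theta>, v). t \<theta> v)"
proof -
  define R where "R = (\<lambda>\<theta>. indicator \<Theta> \<theta> *\<^sub>R rent_upto \<theta>)"
  define E where "E = (\<lambda>\<theta>. indicator \<Theta> \<theta> *\<^sub>R expected_slack \<theta>)"
  define S where "S = (\<lambda>z. indicator (\<Theta> \<times> V) z *\<^sub>R (case z of (\<theta>, v) \<Rightarrow> slack \<theta> v))"
  define H where "H = (\<lambda>z. indicator (\<Theta> \<times> V) z *\<^sub>R (case z of (\<theta>, v) \<Rightarrow> gain qs \<theta> v))"
  have [measurable]: "R \<in> borel_measurable borel" "E \<in> borel_measurable borel"
    "S \<in> borel_measurable (borel \<Otimes>\<^sub>M borel)" "H \<in> borel_measurable (borel \<Otimes>\<^sub>M borel)"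
    using set_borel_measurable_mono_on[OF rent_upto_mono] set_borel_measurable_expected_slack
      set_borel_measurable_slack set_borel_measurable_gain[OF set_borel_measurable_qs]
    unfolding set_borel_measurable_def borel_prod R_def E_def S_def H_def by blast+
  have "(\<lambda>z. snd z * H z - indicator (\<Theta> \<times> V) z * (R (fst z) - E (fst z)) - S z)
    \<in> borel_measurable (borel \<Otimes>\<^sub>M borel)" (is "?h \<in> _")
    by measurable
  also have "?h = (\<lambda>z. indicator (\<Theta> \<times> V) z *\<^sub>R (case z of (\<theta>, v) \<Rightarrow> t \<theta> v))"
  proof
    fix z show "?h z = indicator (\<Theta> \<times> V) z *\<^sub>R (case z of (\<theta>, v) \<Rightarrow> t \<theta> v)"
    proof (cases "z \<in> \<Theta> \<times> V")
      case True
      then obtain \<theta> v where "z = (\<theta>, v)" "\<theta> \<in> \<Theta>" "v \<in> V" by auto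
      then show ?thesis by (simp add: transfer_eq R_def E_def S_def H_def)
    qed (simp add: S_def H_def)
  qed
  finally show ?thesis by (simp add: set_borel_measurable_def borel_prod)
qed

lemma envelope_mechanism_qs: "envelope_mechanism qs t"
proof -
  have "\<forall>\<theta>\<in>\<Theta>. \<forall>v\<in>V. util qs t \<theta> v = util qs t \<theta> vl + (LINT x:{vl..v}|lborel. gain qs \<theta> x)"
    using t unfolding transfer_equations_def Let_def by blast
  then show ?thesis
    unfolding envelope_mechanism_def
    using qs_nonneg set_borel_measurable_qs set_borel_measurable_transfer mono_on_gain_qs by blast
qed

lemma set_integrable_profit_qs:
  "set_integrable (joint_dist \<Theta> V f g) (\<Theta> \<times> V) (\<lambda>(\<theta>, v). t \<theta> v - qs \<theta> v * c)"
proof (rule set_integrable_bounded[OF _ emeasure_joint_dist_finite])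
  have "set_borel_measurable borel (\<Theta> \<times> V) (\<lambda>(\<theta>, v). t \<theta> v - qs \<theta> v * c)"
    using set_borel_measurable_qs set_borel_measurable_transfer
    by (subst set_borel_measurable_restrict_space_iff; simp add: set_borel_measurable_restrict_space_iff borel_Times split_beta')
  then show "set_borel_measurable (joint_dist \<Theta> V f g) (\<Theta> \<times> V) (\<lambda>(\<theta>, v). t \<theta> v - qs \<theta> v * c)"
    by (simp add: set_borel_measurable_def joint_dist_def)
  show "\<Theta> \<times> V \<in> sets (joint_dist \<Theta> V f g)"
    by (simp add: joint_dist_def borel_Times)
  fix z assume "z \<in> \<Theta> \<times> V"
  then obtain \<theta> v where z: "z = (\<theta>, v)" "\<theta> \<in> \<Theta>" "v \<in> V" by auto
  have "\<bar>v * gain qs \<theta> v\<bar> \<le> (\<bar>vl\<bar> + \<bar>vh\<bar>) * gain qs \<theta>h vh"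
    unfolding abs_mult using z gain_qs_le[of \<theta> v] by (intro mult_mono) auto
  moreover have "0 \<le> qs \<theta> v * c" "qs \<theta> v * c \<le> qs \<theta>h vh * c"
    using qs_nonneg[of \<theta> v] qs_mono[of \<theta> \<theta>h v vh] z cost signals vals by (auto intro!: mult_right_mono)
  moreover have "0 \<le> rent_upto \<theta>" "rent_upto \<theta> \<le> rent_upto \<theta>h"
    using rent_upto_nonneg[of \<theta>] mono_onD[OF rent_upto_mono, of \<theta> \<theta>h] z signals by auto
  moreover note slack_bounds[OF z(2,3)] expected_slack_bounds[OF z(2)]
  \<comment> \<open>One summand for each term of profit; \<open>slack_bound\<close> occurs twice
    because it bounds both \<open>slack\<close> and its expectation.\<close>
  ultimately show "\<bar>case z of (\<theta>, v) \<Rightarrow> t \<theta> v - qs \<theta> v * c\<bar> \<le>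
      (\<bar>vl\<bar> + \<bar>vh\<bar>) * gain qs \<theta>h vh + qs \<theta>h vh * c + rent_upto \<theta>h + 2 * slack_bound"
    unfolding z(1) prod.case transfer_eq[OF z(2,3)] by linarith
qed

text \<open>Converse of the envelope argument: over the interval between \<open>w\<close> and
  \<open>v\<close>, a monotone gain lies on one side of its value at \<open>w\<close>, and either
  order of the two gives the subgradient inequality.\<close>

lemma IC1_qs: "IC1 \<alpha> \<Theta> V qs t"
  unfolding IC1_def
proof (intro ballI)
  fix \<theta> v w assume *: "\<theta> \<in> \<Theta>" "v \<in> V" "w \<in> V"
  note E = envelope_mechanismD(5)[OF envelope_mechanism_qs]
  have int: "gain qs \<theta> integrable_on {x..y}" if "x \<in> V" "y \<in> V" for x y
    using that * by (intro integrable_on_mono_on mono_on_subset[OF mono_on_gain_qs]) auto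
  have slack_eq: "slack \<theta> x = integral {vl..x} (gain qs \<theta>)" if "x \<in> V" for x
    unfolding slack_def using that *
    by (intro set_borel_integral_eq_integral set_integrable_mono_on mono_on_subset[OF mono_on_gain_qs]) auto
  have "(v - w) * gain qs \<theta> w \<le> slack \<theta> v - slack \<theta> w"
  proof (cases "w \<le> v")
    case True
    have "integral {vl..w} (gain qs \<theta>) + integral {w..v} (gain qs \<theta>) = integral {vl..v} (gain qs \<theta>)"
      using True * int by (intro Henstock_Kurzweil_Integration.integral_combine) auto
    moreover have "integral {w..v} (\<lambda>_. gain qs \<theta> w) \<le> integral {w..v} (gain qs \<theta>)"
      using True * int by (intro integral_le) (auto intro!: gain_qs_mono)
    ultimately show ?thesis using True * by (simp add: slack_eq)
  next
    case False
    have "integral {vl..v} (gain qs \<theta>) + integral {v..w} (gain qs \<theta>) = integral {vl..w} (gain qs \<theta>)"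
      using False * int by (intro Henstock_Kurzweil_Integration.integral_combine) auto
    moreover have "integral {v..w} (gain qs \<theta>) \<le> integral {v..w} (\<lambda>_. gain qs \<theta> w)"
      using False * int by (intro integral_le) (auto intro!: gain_qs_mono)
    ultimately show ?thesis using False * by (simp add: slack_eq algebra_simps)
  qed
  then show "buyer_util \<alpha> v (qs \<theta> w) (t \<theta> w) \<le> util qs t \<theta> v"
    using * by (simp add: buyer_util_def transfer_eq algebra_simps)
qed

text \<open>The advantage over truthful signal \<theta>' is the rent of the schedule frozen at
  \<theta>'. Reports below the true signal use the lower bound on the increment of
  \<open>rent_upto\<close>, reports above it the upper bound with signs reversed.\<close>

lemma IC0_qs: "IC0 \<alpha> \<Theta> V G qs t"
  unfolding IC0_def
proof (intro ballI)
  fix \<theta> \<theta>' assume *: "\<theta> \<in> \<Theta>" "\<theta>' \<in> \<Theta>"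
  have "(LINT x:V|lborel. gain qs \<theta>' x * (cdf (G \<theta>') x - cdf (G \<theta>) x)) \<le> rent_upto \<theta> - rent_upto \<theta>'"
  proof (cases "\<theta>' \<le> \<theta>")
    case True
    then show ?thesis using rent_upto_diff_bounds(1)[of \<theta>' \<theta>] * by simp
  next
    case False
    have "(LINT x:V|lborel. gain qs \<theta>' x * (cdf (G \<theta>') x - cdf (G \<theta>) x)) =
      (LINT x:V|lborel. - (gain qs \<theta>' x * (cdf (G \<theta>) x - cdf (G \<theta>') x)))"
      by (simp add: algebra_simps)
    also have "\<dots> = - (LINT x:V|lborel. gain qs \<theta>' x * (cdf (G \<theta>) x - cdf (G \<theta>') x))"
      by (simp add: set_lebesgue_integral_def)
    finally show ?thesis using rent_upto_diff_bounds(2)[of \<theta> \<theta>'] * False by simp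
  qed
  then show "interim qs t \<theta> \<theta>' \<le> interim qs t \<theta> \<theta>"
    using interim_diff[OF envelope_mechanism_qs *] interim_qs * by simp
qed

lemma feasible_qs: "feasible \<alpha> c \<Theta> V f g G qs t"
  unfolding feasible_def IR_def
  using qs_nonneg set_borel_measurable_qs set_borel_measurable_transfer set_integrable_profit_qs
    IC0_qs IC1_qs interim_qs rent_upto_nonneg by auto

text \<open>Here interim utility equals the rent, so the only inequality in the bound on profit is
  attained.\<close>

lemma expected_profit_qs:
  "expected_profit c \<Theta> V f g qs t = (LINT \<theta>:\<Theta>|lborel. virtual_surplus qs \<theta>)"
proof -
  note P = profit_eq[OF envelope_mechanism_qs set_integrable_profit_qs set_integrable_interim_feasible[OF feasible_qs]]
  have "(LINT \<theta>:\<Theta>|F. interim qs t \<theta> \<theta>) = (LINT \<theta>:\<Theta>|F. LINT x:{\<theta>l..\<theta>}|lborel. rent (gain qs) x)"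
    using sets_F by (intro set_lebesgue_integral_cong) (auto simp: interim_qs rent_upto_def)
  then show ?thesis
    using P(2) set_integral_virtual_surplus[OF set_borel_measurable_qs P(1) integrable_rent_qs] by simp
qed

lemma optimal_mechanism_qs: "optimal_mechanism \<alpha> c \<Theta> V f g G qs t"
proof -
  have "expected_profit c \<Theta> V f g q' t' \<le> expected_profit c \<Theta> V f g qs t"
    if feas: "feasible \<alpha> c \<Theta> V f g G q' t'" for q' t'
  proof -
    have "expected_profit c \<Theta> V f g q' t' \<le> (LINT \<theta>:\<Theta>|lborel. virtual_surplus q' \<theta>)"
      by (rule profit_le_virtual_surplus(2)[OF feas])
    also have "\<dots> \<le> (LINT \<theta>:\<Theta>|lborel. virtual_surplus qs \<theta>)"
    proof (rule set_integral_virtual_surplus_mono)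
      show "envelope_mechanism q' t'" by (rule feasible_envelope_mechanism[OF feas])
      then show "virtual_value F f g dG \<theta> v * gain q' \<theta> v - c * q' \<theta> v \<le>
          virtual_value F f g dG \<theta> v * gain qs \<theta> v - c * qs \<theta> v" if "\<theta> \<in> \<Theta>" "v \<in> V" for \<theta> v
        using that by (intro q_star_maximizes alpha cost envelope_mechanismD(1))
    qed (rule envelope_mechanism_qs integrable_rent_qs integrable_rent_feasible[OF feas]
          profit_le_virtual_surplus(1)[OF feas] profit_le_virtual_surplus(1)[OF feasible_qs])+
    finally show ?thesis by (simp add: expected_profit_qs)
  qed
  then show ?thesis
    unfolding optimal_mechanism_def is_arg_max_linorder using feasible_qs by auto
qed

end

text \<open>Ensures that optimality of every solution is not a vacuous claim.\<close>

lemma transfer_equations_exist: "\<exists>t. transfer_equations \<alpha> \<theta>l \<theta>h vl vh G dG qs t"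
  unfolding transfer_equations_iff
  by (rule exI[of _ "\<lambda>\<theta> v. v * gain qs \<theta> v - (rent_upto \<theta> - expected_slack \<theta> + slack \<theta> v)"]) simp

end

theorem theorem1:
  fixes \<alpha> c \<theta>l \<theta>h vl vh :: real
    and F :: "real measure" and G :: "real \<Rightarrow> real measure"
    and f :: "real \<Rightarrow> real" and g dG :: "real \<Rightarrow> real \<Rightarrow> real"
  defines "\<Theta> \<equiv> {\<theta>l..\<theta>h}" and "V \<equiv> {vl..vh}"
  defines "\<phi> \<equiv> virtual_value F f g dG"
  defines "q \<equiv> q_star \<alpha> c \<phi>"
  assumes alpha: "0 < \<alpha>" "\<alpha> < 1" and cost: "0 < c"
    and signals: "0 \<le> \<theta>l" "\<theta>l < \<theta>h" and vals: "vl < vh"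
    and F: "has_pos_density_on F f \<Theta>"
    and G: "\<And>\<theta>. \<theta> \<in> \<Theta> \<Longrightarrow> has_pos_density_on (G \<theta>) (g \<theta>) V"
    and g_meas: "set_borel_measurable borel (\<Theta> \<times> V) (\<lambda>(\<theta>, v). g \<theta> v)"
    and dG: "\<And>\<theta> v. \<theta> \<in> \<Theta> \<Longrightarrow> v \<in> V \<Longrightarrow>
               ((\<lambda>x. cdf (G x) v) has_real_derivative dG \<theta> v) (at \<theta> within \<Theta>)"
    and fosd: "\<And>\<theta> \<theta>' v. \<theta> \<in> \<Theta> \<Longrightarrow> \<theta>' \<in> \<Theta> \<Longrightarrow> \<theta>' < \<theta> \<Longrightarrow> v \<in> {vl<..<vh} \<Longrightarrow>
               cdf (G \<theta>) v < cdf (G \<theta>') v"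
    and regular: "\<And>v. v \<in> V \<Longrightarrow> mono_on \<Theta> (\<lambda>\<theta>. \<phi> \<theta> v)"
                 "\<And>\<theta>. \<theta> \<in> \<Theta> \<Longrightarrow> mono_on V (\<lambda>v. \<phi> \<theta> v)"
  shows "(\<exists>t. transfer_equations \<alpha> \<theta>l \<theta>h vl vh G dG q t) \<and>
         (\<forall>t. transfer_equations \<alpha> \<theta>l \<theta>h vl vh G dG q t \<longrightarrow>
              optimal_mechanism \<alpha> c \<Theta> V f g G q t)"
proof -
  interpret regular_screening \<alpha> c \<theta>l \<theta>h vl vh F G f g dG
    using assms unfolding \<Theta>_def V_def \<phi>_def by unfold_locales auto
  show ?thesis
    using transfer_equations_exist optimal_mechanism_qs unfolding q_def \<phi>_def \<Theta>_def V_def by blast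
qed

end
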